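(* Let $G$ be a finite, simple, connected graph on $\nu$ vertices with connectivity $\kappa(G)\geq\nu/2$, and let $M$ be a perfect matching of $G$. Then either $G$ has an $M$-alternating Hamilton cycle, or $G\in\mathcal{G}_1$ and $M$ is the jointing matching of $G$.
   Context: $\kappa(G)$ is the vertex connectivity of $G$. A perfect matching $M$ is a set of pairwise non-adjacent edges covering every vertex. An $M$-alternating Hamilton cycle is a cycle through all vertices whose edges lie alternately in $M$ and in $E(G)\setminus M$. $\mathcal{G}_1$ is the class of graphs obtained, for some integer $n\geq 1$, by taking two disjoint copies of the complete graph $K_{2n+1}$ with vertex sets $\{x_{1},\ldots, x_{2n+1}\}$ and $\{y_{1},\ldots, y_{2n+1}\}$ and adding the edges $x_iy_i$ for $1\leq i\leq 2n+1$; the jointing matching of such a graph is $\{x_iy_i:1\leq i\leq 2n+1\}$.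
   Formalization: The graph is additionally assumed not to have exactly two vertices: for K_2, connectivity 1 ≥ ν/2 and its edge is a perfect matching, but it has no Hamilton cycle and is not in G_1 (n ≥ 1), so the claim fails there. *)

theory Defs
  imports "Graph_Theory.Graph_Theory"
begin

text \<open>
  As in the theory of Kuratowski subgraphs of the imported library, an undirected graph is a
  symmetric digraph: a finite simple graph is a \<^term>\<open>G\<close> with \<^prop>\<open>pair_graph G\<close>, in which every
  edge is present as two opposite arcs. The undirected edges are recovered as two-element sets.
\<close>

definition uedge :: "'a \<times> 'a \<Rightarrow> 'a set" where
  "uedge e = {fst e, snd e}"

definition uedges :: "'a pair_pre_digraph \<Rightarrow> 'a set set" where
  "uedges G = uedge ` parcs G"

text \<open>
  The connectivity is the least number of vertices whose deletion leaves a disconnected graph or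
  at most one vertex; so the complete graph on \<open>n \<ge> 1\<close> vertices has connectivity \<open>n - 1\<close>.
\<close>

definition vertex_connectivity :: "'a pair_pre_digraph \<Rightarrow> nat" where
  "vertex_connectivity G = (LEAST k. \<exists>S \<subseteq> pverts G. card S = k \<and>
     (card (pverts G - S) \<le> 1 \<or> \<not> connected (with_proj G \<restriction> (pverts G - S))))"

definition perfect_matching :: "'a pair_pre_digraph \<Rightarrow> 'a set set \<Rightarrow> bool" where
  "perfect_matching G M \<longleftrightarrow> M \<subseteq> uedges G \<and> pairwise disjnt M \<and> \<Union> M = pverts G"

text \<open>
  The library's cycles are closed arc walks and may have length 2 (traversing an edge back and
  forth), hence the additional bound on the length.
\<close>

definition hamilton_cycle :: "'a pair_pre_digraph \<Rightarrow> ('a \<times> 'a) awalk \<Rightarrow> bool" where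
  "hamilton_cycle G p \<longleftrightarrow>
     pre_digraph.cycle (with_proj G) p \<and> length p \<ge> 3 \<and> fst ` set p = pverts G"

text \<open>Indices are taken modulo the length, so that the last and the first edge alternate as well.\<close>

definition alternating_cycle :: "'a set set \<Rightarrow> ('a \<times> 'a) awalk \<Rightarrow> bool" where
  "alternating_cycle M p \<longleftrightarrow>
     (\<forall>i < length p. uedge (p ! i) \<in> M \<longleftrightarrow> uedge (p ! (Suc i mod length p)) \<notin> M)"

text \<open>
  The vertices \<open>x 1, \<dots>, x (2n+1)\<close> and \<open>y 1, \<dots>, y (2n+1)\<close> exhibit \<open>G\<close> as two disjoint complete
  graphs joined by the edges \<open>x i, y i\<close>.
\<close>

definition G1_labelling ::
    "nat \<Rightarrow> (nat \<Rightarrow> 'a) \<Rightarrow> (nat \<Rightarrow> 'a) \<Rightarrow> 'a pair_pre_digraph \<Rightarrow> bool" where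
  "G1_labelling n x y G \<longleftrightarrow> (let I = {1..2 * n + 1} in
     inj_on x I \<and> inj_on y I \<and> x ` I \<inter> y ` I = {} \<and>
     pverts G = x ` I \<union> y ` I \<and>
     parcs G = {(x i, x j) | i j. i \<in> I \<and> j \<in> I \<and> i \<noteq> j} \<union>
               {(y i, y j) | i j. i \<in> I \<and> j \<in> I \<and> i \<noteq> j} \<union>
               {(x i, y i) | i. i \<in> I} \<union> {(y i, x i) | i. i \<in> I})"

definition class_G1 :: "'a pair_pre_digraph set" where
  "class_G1 = {G. \<exists>n \<ge> 1. \<exists>x y. G1_labelling n x y G}"

definition jointing_matching :: "'a pair_pre_digraph \<Rightarrow> 'a set set \<Rightarrow> bool" where
  "jointing_matching G M \<longleftrightarrow>
     (\<exists>n \<ge> 1. \<exists>x y. G1_labelling n x y G \<and> M = {{x i, y i} | i. i \<in> {1..2 * n + 1}})"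

end

(*
  Orient every matching edge and write x -> x' if the mate of x is adjacent to x'; alternating paths
  that begin and end with matching edges, and alternating cycles, become lists of vertices. Let C be
  a longest alternating cycle (a single matching edge counts as one), with c < m = nu/2 matching
  edges, and let P be a longest such path outside C, with k matching edges and ends p, q.
  Maximality of C bounds the neighbours of p and q on C: if p is adjacent to y_i and q to x_j, then
  j is not among i+1, ..., i+k, so |A| + |B| + k <= c + 1 for the index sets A, B if both are
  nonempty. Since all degrees are at least m, P closes up to a cycle; if k >= 2, the bounds force
  P to have fewer than m neighbours outside P, or only neighbours on one side of C, which is a cut.
  So k = 1 and m = c + 1, and every bound is attained, for C and for every cycle obtained by
  exchanging the omitted edge uv with an edge of C. Comparing these equalities shows that the edges
  outside M on C lie alternately in N(u) and in N(v), and then that G consists of two cliques of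
  odd order m joined by M.
*)
theory Submission
  imports Defs
begin

section \<open>Alternating paths and cycles\<close>

text \<open>The arithmetic has no slack. If both gap bounds apply to the ends of P, the ends have
  together at most 2(c + 1 - k) neighbours on C and 2(2k - 1) on P, in all 2(c + k) \<le> 2m, while
  the degrees demand 2m; hence all bounds are attained at once. The obstacle is that a gap bound
  says nothing when one of its index sets is empty. Then either the degree of some vertex of C is
  too small, or connectivity is used directly: a set of fewer than m vertices of C would be a cut.
  Three symmetries halve the cases: reversing P exchanges its ends, reversing C exchanges the
  \<open>x i\<close> with their mates, and in the extremal case u and v can be exchanged.\<close>

locale matched_graph =
  fixes V :: "'a set" and adj :: "'a \<Rightarrow> 'a \<Rightarrow> bool" and mu :: "'a \<Rightarrow> 'a"
  assumes finite_V: "finite V"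
    and adj_sym: "adj a b \<Longrightarrow> adj b a"
    and adj_irrefl: "\<not> adj a a"
    and adj_V: "adj a b \<Longrightarrow> a \<in> V"
    and mu_V: "a \<in> V \<Longrightarrow> mu a \<in> V"
    and mu_mu [simp]: "mu (mu a) = a"
    and adj_mu: "a \<in> V \<Longrightarrow> adj a (mu a)"
begin

lemma adj_commute: "adj a b \<longleftrightarrow> adj b a"
  using adj_sym by blast

lemma adj_V2: "adj a b \<Longrightarrow> b \<in> V"
  using adj_sym adj_V by blast

lemma mu_V_iff [simp]: "mu a \<in> V \<longleftrightarrow> a \<in> V"
  using mu_V[of a] mu_V[of "mu a"] by auto

lemma mu_neq: "a \<in> V \<Longrightarrow> mu a \<noteq> a"
  using adj_mu[of a] adj_irrefl[of a] by metis

lemma mu_eq_iff [simp]: "mu a = mu b \<longleftrightarrow> a = b"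
  by (metis mu_mu)

lemma inj_mu: "inj_on mu A"
  by (simp add: inj_on_def)

definition vset :: "'a list \<Rightarrow> 'a set" where
  "vset xs = set xs \<union> mu ` set xs"

text \<open>
  An entry \<open>a\<close> of a list stands for the matching edge from \<open>a\<close> to \<open>mu a\<close>; consecutive entries are
  joined by an edge from the mate of the first to the second. In particular the list \<open>[a]\<close> is an
  alternating cycle.
\<close>

definition alt_path :: "'a list \<Rightarrow> bool" where
  "alt_path xs \<longleftrightarrow> xs \<noteq> [] \<and> set xs \<subseteq> V \<and> distinct xs \<and> set xs \<inter> mu ` set xs = {} \<and>
     successively (\<lambda>a b. adj (mu a) b) xs"

definition alt_cycle :: "'a list \<Rightarrow> bool" where
  "alt_cycle xs \<longleftrightarrow> alt_path xs \<and> adj (mu (last xs)) (hd xs)"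

text \<open>A path traversed backwards enters every matching edge at its other end, hence the
  \<open>mu\<close>.\<close>

definition rv :: "'a list \<Rightarrow> 'a list" where
  "rv xs = map mu (rev xs)"

lemma vset_mu [simp]: "mu a \<in> vset xs \<longleftrightarrow> a \<in> vset xs"
  unfolding vset_def by (auto simp: image_iff) (metis mu_mu)+

lemma vset_mem_iff: "a \<in> vset xs \<longleftrightarrow> a \<in> set xs \<or> mu a \<in> set xs"
  unfolding vset_def by (auto simp: image_iff) (metis mu_mu)+

lemma vset_append [simp]: "vset (xs @ ys) = vset xs \<union> vset ys"
  by (auto simp: vset_def)

lemma vset_Nil [simp]: "vset [] = {}"
  by (simp add: vset_def)

lemma vset_Cons [simp]: "vset (x # xs) = {x, mu x} \<union> vset xs"
  by (auto simp: vset_def)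

lemma rv_simps [simp]: "rv [] = []" "rv xs = [] \<longleftrightarrow> xs = []" "length (rv xs) = length xs"
  "rv (rv xs) = xs" "rv (xs @ ys) = rv ys @ rv xs" "rv (x # xs) = rv xs @ [mu x]"
  by (auto simp: rv_def rev_map comp_def)

lemma hd_rv: "xs \<noteq> [] \<Longrightarrow> hd (rv xs) = mu (last xs)"
  by (simp add: rv_def hd_map hd_rev)

lemma last_rv: "xs \<noteq> [] \<Longrightarrow> last (rv xs) = mu (hd xs)"
  by (simp add: rv_def last_map last_rev)

lemma set_rv: "set (rv xs) = mu ` set xs"
  by (simp add: rv_def)

lemma vset_rv [simp]: "vset (rv xs) = vset xs"
  by (auto simp: vset_def set_rv image_image)

lemma finite_vset [simp]: "finite (vset xs)"
  by (simp add: vset_def)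

lemma alt_path_not_Nil: "alt_path xs \<Longrightarrow> xs \<noteq> []"
  by (simp add: alt_path_def)

lemma vset_subset_V: "alt_path xs \<Longrightarrow> vset xs \<subseteq> V"
  by (auto simp: alt_path_def vset_def)

lemma card_vset: "alt_path xs \<Longrightarrow> card (vset xs) = 2 * length xs"
  unfolding vset_def alt_path_def
  by (simp add: card_Un_disjoint card_image inj_mu distinct_card)

lemma alt_path_append:
  assumes "xs \<noteq> []" "ys \<noteq> []"
  shows "alt_path (xs @ ys) \<longleftrightarrow>
    alt_path xs \<and> alt_path ys \<and> vset xs \<inter> vset ys = {} \<and> adj (mu (last xs)) (hd ys)"
  using assms unfolding alt_path_def vset_def
  by (auto simp: successively_append_iff)

lemma alt_path_singleton [simp]: "alt_path [a] \<longleftrightarrow> a \<in> V"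
  using mu_neq[of a] by (auto simp: alt_path_def)

lemma alt_path_rv [simp]: "alt_path (rv xs) \<longleftrightarrow> alt_path xs"
proof -
  have *: "alt_path (rv xs)" if "alt_path xs" for xs
  proof -
    have "successively (\<lambda>a b. adj (mu a) b) (rv xs)"
      using that unfolding rv_def alt_path_def
      by (auto simp: successively_map adj_commute)
    then show ?thesis
      using that unfolding alt_path_def
      by (auto simp: set_rv image_image rv_def distinct_map inj_mu)
  qed
  show ?thesis using *[of xs] *[of "rv xs"] by auto
qed

lemma alt_path_appendD1: "alt_path (xs @ ys) \<Longrightarrow> xs \<noteq> [] \<Longrightarrow> alt_path xs"
  using alt_path_append[of xs ys] by (cases "ys = []") auto

lemma alt_cycle_rotate: "alt_cycle (xs @ ys) \<Longrightarrow> alt_cycle (ys @ xs)"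
proof (cases "xs = [] \<or> ys = []")
  case False
  assume "alt_cycle (xs @ ys)"
  with False show ?thesis
    unfolding alt_cycle_def by (auto simp: alt_path_append)
qed auto

lemma alt_cycle_rv: "alt_cycle xs \<Longrightarrow> alt_cycle (rv xs)"
  unfolding alt_cycle_def
  by (metis adj_sym alt_path_not_Nil alt_path_rv hd_rv last_rv mu_mu)

lemma alt_cycle_append:
  assumes "xs \<noteq> []" "ys \<noteq> []"
  shows "alt_cycle (xs @ ys) \<longleftrightarrow> alt_path xs \<and> alt_path ys \<and> vset xs \<inter> vset ys = {} \<and>
     adj (mu (last xs)) (hd ys) \<and> adj (mu (last ys)) (hd xs)"
  using assms by (auto simp: alt_cycle_def alt_path_append)

lemma alt_cycle_singleton: "a \<in> V \<Longrightarrow> alt_cycle [a]"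
  using adj_mu adj_sym by (simp add: alt_cycle_def)

lemma alt_path_nth_adj:
  assumes "alt_path ps" "Suc i < length ps"
  shows "adj (mu (ps ! i)) (ps ! Suc i)"
  using assms by (simp add: alt_path_def successively_conv_nth)

text \<open>A Posa rotation: the edge from the head to \<open>ps ! i\<close> replaces the edge that
  enters \<open>ps ! i\<close>, the initial part is reversed, and the far end stays.\<close>

lemma rotate_hd:
  assumes "alt_path ps" "0 < i" "i < length ps" "adj (hd ps) (ps ! i)"
  shows "alt_path (rv (take i ps) @ drop i ps)"
proof -
  have ne: "take i ps \<noteq> []" "drop i ps \<noteq> []" using assms by auto
  have "alt_path (take i ps @ drop i ps)" using assms(1) by simp
  then have "alt_path (take i ps)" "alt_path (drop i ps)" "vset (take i ps) \<inter> vset (drop i ps) = {}"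
    using alt_path_append[OF ne] by auto
  then show ?thesis
    using ne assms by (subst alt_path_append) (auto simp: last_rv hd_drop_conv_nth)
qed

lemma rotate_last:
  assumes "alt_path ps" "0 < i" "i < length ps" "adj (mu (last ps)) (mu (ps ! (i - 1)))"
  shows "alt_path (take i ps @ rv (drop i ps))"
proof -
  have ne: "take i ps \<noteq> []" "drop i ps \<noteq> []" using assms by auto
  have "alt_path (take i ps @ drop i ps)" using assms(1) by simp
  then have "alt_path (take i ps)" "alt_path (drop i ps)" "vset (take i ps) \<inter> vset (drop i ps) = {}"
    using alt_path_append[OF ne] by auto
  then show ?thesis
    using ne assms by (subst alt_path_append) (auto simp: hd_rv last_conv_nth adj_commute)
qed

end

section \<open>Longest alternating cycles\<close>

text \<open>
  Each of the \<open>k\<close> shifts of \<open>I\<close> after the first adds a new residue to their union, because that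
  union misses \<open>J\<close> and so is not invariant under the shift.
\<close>

lemma gap_count:
  fixes I J :: "int set"
  assumes IJ: "I \<subseteq> {0..<int c}" "J \<subseteq> {0..<int c}" "I \<noteq> {}" "J \<noteq> {}" and k: "1 \<le> k"
    and gap: "\<And>i j d. i \<in> I \<Longrightarrow> j \<in> J \<Longrightarrow> 1 \<le> d \<Longrightarrow> d \<le> int k \<Longrightarrow> (i + d) mod int c \<noteq> j"
  shows "card I + card J + k \<le> c + 1"
proof -
  have c: "int c > 0" using IJ by fastforce
  have fin: "finite I" "finite J" using IJ finite_subset by blast+
  define S where "S t = (\<lambda>(i, d). (i + d) mod int c) ` (I \<times> {1..int t})" for t :: nat
  have S_sub: "S t \<subseteq> {0..<int c}" for t using c by (auto simp: S_def)
  then have finS: "finite (S t)" for t using finite_subset by blast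
  have S_mono: "S t \<subseteq> S (Suc t)" for t by (auto simp: S_def)
  have S_step: "(s + 1) mod int c \<in> S (Suc t)" if "s \<in> S t" for s t
  proof -
    have "s \<in> (\<lambda>(i, d). (i + d) mod int c) ` (I \<times> {1..int t})" using that by (simp add: S_def)
    then obtain i d where "i \<in> I" "1 \<le> d" "d \<le> int t" "s = (i + d) mod int c"
      by (elim imageE SigmaE) auto
    then have "(i, d + 1) \<in> I \<times> {1..int (Suc t)}" "(s + 1) mod int c = (i + (d + 1)) mod int c"
      by (auto simp: mod_simps add_ac)
    then show ?thesis unfolding S_def by (intro image_eqI[where x = "(i, d + 1)"]) auto
  qed
  have S_J: "S t \<inter> J = {}" if "t \<le> k" for t
    using gap that by (fastforce simp: S_def)
  have "card I + t \<le> card (S t) + 1" if "1 \<le> t" "t \<le> k" for t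
    using that
  proof (induction t rule: dec_induct)
    case base
    have "inj_on (\<lambda>i. (i + 1) mod int c) I"
    proof (rule inj_onI)
      fix i j assume "i \<in> I" "j \<in> I" "(i + 1) mod int c = (j + 1) mod int c"
      then have "(i + 1 - 1) mod int c = (j + 1 - 1) mod int c" by (metis mod_diff_left_eq)
      with \<open>i \<in> I\<close> \<open>j \<in> I\<close> show "i = j" using IJ by (simp add: subset_iff)
    qed
    moreover have "S 1 = (\<lambda>i. (i + 1) mod int c) ` I" by (auto simp: S_def image_iff)
    ultimately show ?case by (simp add: card_image)
  next
    case (step t)
    have "S t \<noteq> S (Suc t)"
    proof
      assume eq: "S t = S (Suc t)"
      obtain i where "i \<in> I" using IJ by blast
      have in_S: "(i + 1 + int n) mod int c \<in> S t" for n
      proof (induction n)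
        case 0 show ?case using \<open>i \<in> I\<close> step by (auto simp: S_def)
      next
        case (Suc n)
        then show ?case using S_step[OF Suc] eq by (simp add: mod_simps add_ac)
      qed
      \<comment> \<open>The number of unit shifts that lead from \<open>i + 1\<close> to
        \<open>j\<close> modulo c.\<close>
      obtain j where "j \<in> J" using IJ by blast
      have "(i + 1 + int (nat ((j - i - 1) mod int c))) mod int c = j"
        using c \<open>j \<in> J\<close> IJ by (auto simp: mod_simps subset_iff)
      with in_S have "j \<in> S t" by metis
      with S_J[of t] \<open>j \<in> J\<close> step show False by auto
    qed
    then have "card (S t) < card (S (Suc t))"
      using S_mono finS by (intro psubset_card_mono) auto
    then show ?case using step by simp
  qed
  from this[of k] k have "card I + k \<le> card (S k) + 1" by simp
  moreover have "card (S k) + card J = card (S k \<union> J)"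
    using S_J finS fin by (simp add: card_Un_disjoint)
  moreover have "card (S k \<union> J) \<le> card {0..<int c}"
    using S_sub IJ by (intro card_mono) auto
  ultimately show ?thesis by simp
qed

text \<open>For a single shift the bound survives when one of the sets is empty; for
  \<open>k \<ge> 2\<close> it does not, which is why nonemptiness governs the case distinctions
  below.\<close>

lemma shift_count:
  fixes I J :: "int set"
  assumes IJ: "I \<subseteq> {0..<int c}" "J \<subseteq> {0..<int c}"
    and gap: "\<And>i j. i \<in> I \<Longrightarrow> j \<in> J \<Longrightarrow> (i + 1) mod int c \<noteq> j"
  shows "card I + card J \<le> c"
proof (cases "I = {} \<or> J = {}")
  case True
  have "card I \<le> card {0..<int c}" "card J \<le> card {0..<int c}"
    using IJ by (intro card_mono; simp)+
  with True show ?thesis by auto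
next
  case False
  have "(i + d) mod int c \<noteq> j" if "i \<in> I" "j \<in> J" "1 \<le> d" "d \<le> int 1" for i j d
    using gap[OF that(1,2)] that(3,4) by (metis of_nat_1 order_antisym)
  then show ?thesis using gap_count[OF IJ, of 1] False by auto
qed

lemma finite_residues [simp]: "finite {i. 0 \<le> i \<and> i < int c \<and> P i}"
  by (rule finite_subset[of _ "{0..<int c}"]) auto

text \<open>\<open>longest\<close> only bounds the lengths; that c is attained enters through the
  sequences with \<open>lcyc\<close>. \<open>separation\<close> expresses connectivity at least m,
  and \<open>c_less_m\<close> that no alternating Hamilton cycle exists.\<close>

locale longest_cycle = matched_graph +
  fixes m c :: nat
  assumes card_V: "card V = 2 * m"
    and separation: "\<lbrakk>S \<subseteq> V; card S < m; A \<union> B = V - S; A \<inter> B = {}; A \<noteq> {}; B \<noteq> {}\<rbrakk>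
      \<Longrightarrow> \<exists>a\<in>A. \<exists>b\<in>B. adj a b"
    and longest: "alt_cycle xs \<Longrightarrow> length xs \<le> c"
    and c_less_m: "c < m"
begin

lemma c_pos: "0 < c"
proof -
  obtain a where "a \<in> V" using card_V c_less_m by fastforce
  from longest[OF alt_cycle_singleton[OF this]] show ?thesis by simp
qed

definition nb :: "'a \<Rightarrow> 'a set" where "nb a = {b. adj a b}"

lemma nb_subset_V: "nb a \<subseteq> V"
  using adj_V2 by (auto simp: nb_def)

lemma finite_nb [simp]: "finite (nb a)"
  using nb_subset_V finite_V finite_subset by blast

text \<open>Otherwise the neighbours of \<open>a\<close> would separate it from the remaining
  vertices, of which there are some because the order is 2m.\<close>

lemma min_degree: "a \<in> V \<Longrightarrow> m \<le> card (nb a)"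
proof (rule ccontr)
  assume a: "a \<in> V" and "\<not> m \<le> card (nb a)"
  then have lt: "card (nb a) < m" by simp
  have a': "a \<notin> nb a" by (simp add: nb_def adj_irrefl)
  have "card (insert a (nb a)) < card V"
    using lt card_V a' by simp
  then have "V - insert a (nb a) \<noteq> {}"
    using card_mono[of "insert a (nb a)" V] by force
  then have "\<exists>x\<in>{a}. \<exists>b\<in>V - insert a (nb a). adj x b"
    using a a' nb_subset_V lt by (intro separation[of "nb a"]) auto
  then show False by (auto simp: nb_def)
qed

text \<open>
  A longest alternating cycle as a periodic sequence \<open>x\<close>, with matching edges \<open>x i\<close>, \<open>mu (x i)\<close>. Its
  reversal is \<open>\<lambda>i. mu (x (- i))\<close>, which exchanges the roles of the \<open>x i\<close> and their mates.
\<close>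

definition lcyc :: "(int \<Rightarrow> 'a) \<Rightarrow> bool" where
  "lcyc x \<longleftrightarrow> (\<forall>i. x i \<in> V) \<and> (\<forall>i. x (i + int c) = x i) \<and> (\<forall>i. adj (mu (x i)) (x (i + 1))) \<and>
     (\<forall>i j. x i = x j \<longrightarrow> int c dvd i - j) \<and> (\<forall>i j. x i \<noteq> mu (x j))"

lemma lcycI:
  assumes "\<And>i. x i \<in> V" "\<And>i. x (i + int c) = x i" "\<And>i. adj (mu (x i)) (x (i + 1))"
    "\<And>i j. x i = x j \<Longrightarrow> int c dvd i - j" "\<And>i j. x i \<noteq> mu (x j)"
  shows "lcyc x"
  using assms unfolding lcyc_def by blast

definition cset :: "(int \<Rightarrow> 'a) \<Rightarrow> 'a set" where
  "cset x = range x \<union> mu ` range x"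

lemma cset_mu [simp]: "mu a \<in> cset x \<longleftrightarrow> a \<in> cset x"
  unfolding cset_def by (auto simp: image_iff) (metis mu_mu)

lemma cset_mem [simp]: "x i \<in> cset x"
  by (auto simp: cset_def)

lemma lcycD:
  assumes "lcyc x"
  shows "x i \<in> V" "x (i + int c) = x i" "adj (mu (x i)) (x (i + 1))"
    "x i = x j \<Longrightarrow> int c dvd i - j" "x i \<noteq> mu (x j)"
  using assms by (auto simp: lcyc_def)

lemma lcyc_period:
  assumes "lcyc x"
  shows "x (i + k * int c) = x i"
proof -
  have *: "x (i + int n * int c) = x i" for i n
  proof (induction n)
    case (Suc n)
    have "i + int (Suc n) * int c = i + int n * int c + int c" by (simp add: algebra_simps)
    then have "x (i + int (Suc n) * int c) = x (i + int n * int c)"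
      by (simp only: lcycD(2)[OF assms])
    with Suc show ?case by simp
  qed simp
  show ?thesis
    using *[of i "nat k"] *[of "i + k * int c" "nat (- k)"] by (cases "k \<ge> 0") auto
qed

lemma lcyc_eq_iff: "lcyc x \<Longrightarrow> x i = x j \<longleftrightarrow> int c dvd i - j"
  using lcycD(4) lcyc_period[of x j] by (auto simp: dvd_def algebra_simps)

lemma lcyc_mod: "lcyc x \<Longrightarrow> x (i mod int c) = x i"
  by (subst lcyc_eq_iff) (auto simp: mod_eq_dvd_iff[symmetric])

lemma lcyc_mod_minus: "lcyc x \<Longrightarrow> x (- (i mod int c)) = x (- i)"
  using lcyc_mod[of x "- (i mod int c)"] lcyc_mod[of x "- i"] by (simp add: mod_simps)

lemma lcyc_mod_eq: "lcyc x \<Longrightarrow> i mod int c = j mod int c \<Longrightarrow> x i = x j"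
  by (metis lcyc_mod)

lemma lcyc_rev: "lcyc x \<Longrightarrow> lcyc (\<lambda>i. mu (x (- i)))"
proof -
  assume x: "lcyc x"
  have "adj (x (- i)) (mu (x (- (i + 1))))" for i
    using lcycD(3)[OF x, of "- (i + 1)"] by (simp add: adj_commute)
  moreover have "x (- (i + int c)) = x (- i)" for i
    using lcycD(2)[OF x, of "- i - int c"] by simp
  moreover have "int c dvd i - j" if "x (- i) = x (- j)" for i j
    using lcycD(4)[OF x that] by (metis dvd_minus_iff minus_diff_eq diff_minus_eq_add uminus_add_conv_diff)
  moreover have "mu (x (- i)) \<noteq> x (- j)" for i j
    using lcycD(5)[OF x] by metis
  ultimately show ?thesis using lcycD(1)[OF x] by (auto simp: lcyc_def)
qed

lemma cset_rev [simp]: "cset (\<lambda>i. mu (x (- i))) = cset x"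
proof -
  have r: "range (\<lambda>i. mu (x (- i))) = mu ` range x"
    by (auto simp: image_iff) (metis minus_minus)+
  show ?thesis unfolding cset_def r by (auto simp: image_image)
qed

lemma lcyc_range: "lcyc x \<Longrightarrow> range x = x ` {0..<int c}"
proof -
  assume x: "lcyc x"
  have "x i \<in> x ` {0..<int c}" for i
    using lcyc_mod[OF x, of i] c_pos by (intro image_eqI[where x = "i mod int c"]) auto
  then show ?thesis by auto
qed

lemma lcyc_inj:
  assumes x: "lcyc x"
  shows "inj_on x {0..<int c}"
proof (rule inj_onI)
  fix i j assume ij: "i \<in> {0..<int c}" "j \<in> {0..<int c}" and "x i = x j"
  then have "i mod int c = j mod int c" unfolding mod_eq_dvd_iff by (intro lcycD(4)[OF x])
  with ij show "i = j" by simp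
qed

lemma finite_cset: "lcyc x \<Longrightarrow> finite (cset x)"
  by (simp add: cset_def lcyc_range)

lemma cset_subset_V: "lcyc x \<Longrightarrow> cset x \<subseteq> V"
  using lcycD(1) by (auto simp: cset_def)

lemma card_cset: "lcyc x \<Longrightarrow> card (cset x) = 2 * c"
proof -
  assume x: "lcyc x"
  have "range x \<inter> mu ` range x = {}" using lcycD(5)[OF x] by auto
  then show ?thesis
    unfolding cset_def using lcyc_range[OF x] lcyc_inj[OF x]
    by (simp add: card_Un_disjoint card_image inj_mu)
qed

lemma card_rest: "lcyc x \<Longrightarrow> card (V - cset x) = 2 * (m - c)"
  using card_cset card_V cset_subset_V finite_cset by (simp add: card_Diff_subset)

section \<open>Passing between lists and periodic sequences\<close>

lemma lcyc_of_list:
  assumes "alt_cycle xs" "length xs = c"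
  shows "lcyc (\<lambda>i. xs ! nat (i mod int c))" (is "lcyc ?x")
proof -
  have p: "alt_path xs" and cl: "adj (mu (last xs)) (hd xs)" using assms by (auto simp: alt_cycle_def)
  have b: "nat (i mod int c) < length xs" for i using c_pos assms(2) by (simp add: nat_less_iff)
  have "adj (mu (?x i)) (?x (i + 1))" for i
  proof (cases "i mod int c = int c - 1")
    case True
    then have "(i + 1) mod int c = 0" by (metis mod_add_left_eq diff_add_cancel mod_self)
    then show ?thesis using True cl assms(2) c_pos alt_path_not_Nil[OF p]
      by (simp add: last_conv_nth hd_conv_nth nat_diff_distrib)
  next
    case False
    have "0 \<le> i mod int c" "i mod int c < int c" using c_pos by auto
    then have "(i mod int c + 1) mod int c = i mod int c + 1" using False
      by (intro mod_pos_pos_trivial) auto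
    then have "(i + 1) mod int c = i mod int c + 1" by (simp add: mod_simps)
    then have e: "nat ((i + 1) mod int c) = Suc (nat (i mod int c))"
      using \<open>0 \<le> i mod int c\<close> by simp
    show ?thesis using alt_path_nth_adj[OF p, of "nat (i mod int c)"] b[of "i + 1"] by (simp only: e)
  qed
  moreover have "int c dvd i - j" if "?x i = ?x j" for i j
  proof -
    have "nat (i mod int c) = nat (j mod int c)"
      using that b p by (simp add: alt_path_def nth_eq_iff_index_eq)
    then have "i mod int c = j mod int c" using c_pos
      by (metis eq_nat_nat_iff of_nat_0_less_iff pos_mod_sign)
    then show ?thesis by (simp add: mod_eq_dvd_iff)
  qed
  moreover have in_xs: "?x i \<in> set xs" for i using b by simp
  moreover have "?x i \<noteq> mu (?x j)" for i j
    using in_xs[of i] in_xs[of j] p by (auto simp: alt_path_def)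
  ultimately show "lcyc ?x" using p by (auto simp: lcyc_def alt_path_def)
qed

text \<open>Windows of at most c entries are the pieces from which longer cycles are
  assembled.\<close>

lemma seg_path: "lcyc x \<Longrightarrow> i \<le> j \<Longrightarrow> j < i + int c \<Longrightarrow> alt_path (map x [i..j])"
proof -
  assume x: "lcyc x" and ij: "i \<le> j" "j < i + int c"
  have "inj_on x {i..j}"
  proof (rule inj_onI)
    fix a b assume "a \<in> {i..j}" "b \<in> {i..j}" "x a = x b"
    then have "int c dvd a - b" "\<bar>a - b\<bar> < int c" using lcycD(4)[OF x] ij by auto
    then show "a = b" using zdvd_imp_le[of "int c" "\<bar>a - b\<bar>"] by auto
  qed
  moreover have "set (map x [i..j]) \<inter> mu ` set (map x [i..j]) = {}" using lcycD(5)[OF x] by auto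
  moreover have "adj (mu (x (i + k))) (x (i + (1 + k)))" for k
    using lcycD(3)[OF x, of "i + k"] by (simp only: add_ac)
  then have "successively (\<lambda>a b. adj (mu a) b) (map x [i..j])"
    by (auto simp: successively_conv_nth)
  ultimately show ?thesis using ij lcycD(1)[OF x] by (auto simp: alt_path_def distinct_map)
qed

lemma vset_seg: "vset (map x [i..j]) \<subseteq> cset x"
  by (auto simp: vset_def cset_def)

lemma seg_simps:
  assumes "i \<le> j"
  shows "map x [i..j] \<noteq> []" "hd (map x [i..j]) = x i" "last (map x [i..j]) = x j"
    "length (map x [i..j]) = nat (j - i + 1)"
proof -
  have "map x [i..j] = map x [i..j - 1] @ [x j]" using assms by (simp add: upto_rec2)
  then show "last (map x [i..j]) = x j" by simp
qed (use assms upto_rec1[of i j] in auto)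

text \<open>The second window has to end before the first one recurs a period later, hence
  \<open>j' < i + int c\<close>.\<close>

lemma seg_disjoint:
  assumes x: "lcyc x" and "j < i'" "j' < i + int c"
  shows "vset (map x [i..j]) \<inter> vset (map x [i'..j']) = {}"
proof -
  have "x a \<noteq> x b" if "i \<le> a" "a \<le> j" "i' \<le> b" "b \<le> j'" for a b
  proof
    assume "x a = x b"
    then have "int c dvd b - a" using lcycD(4)[OF x, of b a] by simp
    moreover have "0 < b - a" "b - a < int c" using assms that by auto
    ultimately show False using zdvd_imp_le by force
  qed
  then show ?thesis using lcycD(5)[OF x] unfolding vset_def by (auto 4 4 dest: sym)
qed

section \<open>Exchanges that would lengthen the cycle\<close>

definition off :: "(int \<Rightarrow> 'a) \<Rightarrow> 'a list \<Rightarrow> bool" where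
  "off x ps \<longleftrightarrow> alt_path ps \<and> vset ps \<inter> cset x = {}"

lemma off_rv [simp]: "off x (rv ps) \<longleftrightarrow> off x ps"
  by (simp add: off_def)

lemma off_not_Nil: "off x ps \<Longrightarrow> ps \<noteq> []"
  by (simp add: off_def alt_path_not_Nil)

lemma off_rev_cycle [simp]: "off (\<lambda>i. mu (x (- i))) ps \<longleftrightarrow> off x ps"
  by (simp add: off_def)

text \<open>The path can replace the \<open>j - i - 1\<close> matching edges strictly between
  \<open>x i\<close> and \<open>x j\<close>, and the result must not be longer than C.\<close>

lemma insert_path:
  assumes x: "lcyc x" and ps: "off x ps"
    and a: "adj (hd ps) (mu (x i))" and b: "adj (mu (last ps)) (x j)" and ij: "i < j" "j \<le> i + int c"
  shows "int (length ps) < j - i"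
proof -
  have s: "alt_path (map x [j..i + int c])" using x ij by (intro seg_path) auto
  have "vset ps \<inter> vset (map x [j..i + int c]) = {}" using ps vset_seg[of x j "i + int c"] by (auto simp: off_def)
  then have "alt_cycle (ps @ map x [j..i + int c])"
    using ps a b s ij off_not_Nil[OF ps] seg_simps[OF ij(2), of x] lcycD(2)[OF x]
    by (auto simp: alt_cycle_append off_def adj_commute)
  from longest[OF this] seg_simps(4)[OF ij(2), of x] ij show ?thesis by simp
qed

text \<open>With this chord there would be a cycle through all of C and the path: \<open>ps\<close>,
  then \<open>x (j + 1)\<close> up to \<open>x i\<close>, over the chord to the mate of
  \<open>x j\<close>, and backwards to \<open>x (i + 1)\<close>.\<close>

lemma chord:
  assumes x: "lcyc x" and ps: "off x ps"
    and a: "adj (hd ps) (x (i + 1))" and b: "adj (mu (last ps)) (x (j + 1))"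
    and ij: "x i \<noteq> x j"
  shows "\<not> adj (mu (x i)) (mu (x j))"
proof
  assume e: "adj (mu (x i)) (mu (x j))"
  \<comment> \<open>The representative of \<open>i\<close> in the period that begins at
    \<open>j\<close>; the segments \<open>?s\<close> and \<open>?t\<close> below then make up
    exactly one period.\<close>
  define i' where "i' = j + (i - j) mod int c"
  have "i' mod int c = i mod int c" unfolding i'_def by (simp add: mod_simps)
  then have xi: "x i' = x i" "x (i' + 1) = x (i + 1)"
    using lcyc_mod_eq[OF x, of i' i] lcyc_mod_eq[OF x, of "i' + 1" "i + 1"] mod_add_cong by blast+
  have "(i - j) mod int c \<noteq> 0" using ij lcyc_eq_iff[OF x] by auto
  moreover have "0 \<le> (i - j) mod int c" "(i - j) mod int c < int c" using c_pos by auto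
  ultimately have lt: "j < i'" "i' < j + int c" by (auto simp: i'_def)
  let ?s = "map x [j + 1..i']" and ?t = "map x [i' + 1..j + int c]"
  have s: "alt_path ?s" "alt_path ?t" using x lt by (auto intro!: seg_path)
  have d: "vset ?s \<inter> vset ?t = {}" by (rule seg_disjoint[OF x]) auto
  have dp: "vset ps \<inter> vset ?s = {}" "vset ps \<inter> vset ?t = {}"
    using ps vset_seg[of x "j + 1" i'] vset_seg[of x "i' + 1" "j + int c"] by (auto simp: off_def)
  have h: "?s \<noteq> []" "hd ?s = x (j + 1)" "last ?s = x i" "?t \<noteq> []" "hd ?t = x (i + 1)" "last ?t = x j"
    using seg_simps[of "j + 1" i' x] seg_simps[of "i' + 1" "j + int c" x] lt xi lcycD(2)[OF x] by auto
  have "alt_path (?s @ rv ?t)"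
    using s d e h by (subst alt_path_append) (auto simp: hd_rv)
  moreover have "vset ps \<inter> vset (?s @ rv ?t) = {}" using dp by (simp add: Int_Un_distrib)
  moreover have "hd (?s @ rv ?t) = x (j + 1)" "mu (last (?s @ rv ?t)) = x (i + 1)"
    using h by (auto simp: last_rv)
  ultimately have "alt_cycle (ps @ ?s @ rv ?t)"
    using ps off_not_Nil[OF ps] h(1) a b by (subst alt_cycle_append) (auto simp: off_def adj_commute)
  moreover have "nat (i' - j) + nat (j + (int c - i')) = c" using lt by linarith
  moreover have "length ps > 0" using off_not_Nil[OF ps] by simp
  ultimately show False using longest by fastforce
qed

text \<open>Otherwise the part of the path from its head to \<open>w\<close>, reversed, fits between
  the consecutive vertices \<open>mu (x i)\<close> and \<open>x (i + 1)\<close>, where nothing is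
  lost.\<close>

lemma chord_to_path:
  assumes x: "lcyc x" and ps: "off x ps" and a: "adj (hd ps) (x (i + 1))" and w: "w \<in> set ps"
  shows "\<not> adj (mu (x i)) (mu w)"
proof
  assume e: "adj (mu (x i)) (mu w)"
  obtain p1 p2 where p: "ps = p1 @ w # p2" using w by (meson split_list)
  have "ps = (p1 @ [w]) @ p2" using p by simp
  then have "off x (p1 @ [w])" using ps alt_path_appendD1[of "p1 @ [w]" p2] by (auto simp: off_def)
  then have o: "off x (rv (p1 @ [w]))" by (simp only: off_rv)
  have "hd ps = hd (p1 @ [w])" using p by (cases p1) auto
  then have "mu (last (rv (p1 @ [w]))) = hd ps" "hd (rv (p1 @ [w])) = mu w"
    by (subst last_rv, simp, simp) (subst hd_rv, simp, simp)
  then have "int (length (rv (p1 @ [w]))) < (i + 1) - i"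
    using a e c_pos by (intro insert_path[OF x o]) (auto simp: adj_commute)
  then show False by simp
qed

section \<open>Neighbours on the cycle, counted by index\<close>

definition IX :: "(int \<Rightarrow> 'a) \<Rightarrow> 'a \<Rightarrow> int set" where
  "IX x a = {i \<in> {0..<int c}. adj a (x i)}"

definition IY :: "(int \<Rightarrow> 'a) \<Rightarrow> 'a \<Rightarrow> int set" where
  "IY x a = {i \<in> {0..<int c}. adj a (mu (x i))}"

lemma IX_IY [simp]: "finite (IX x a)" "finite (IY x a)" "IX x a \<subseteq> {0..<int c}" "IY x a \<subseteq> {0..<int c}"
  by (auto simp: IX_def IY_def)

lemma degree_split:
  assumes x: "lcyc x"
  shows "card (nb a) = card (IX x a) + card (IY x a) + card (nb a - cset x)"
proof -
  have eq: "nb a \<inter> cset x = x ` IX x a \<union> mu ` x ` IY x a"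
    unfolding cset_def lcyc_range[OF x] by (auto simp: nb_def IX_def IY_def)
  have inj: "inj_on x (IX x a)" "inj_on x (IY x a)"
    by (rule inj_on_subset[OF lcyc_inj[OF x]], simp)+
  have "x ` IX x a \<inter> mu ` x ` IY x a = {}" using lcycD(5)[OF x] by auto
  then have "card (nb a \<inter> cset x) = card (IX x a) + card (IY x a)"
    unfolding eq using inj by (simp add: card_Un_disjoint card_image inj_mu)
  then show ?thesis using card_Diff_subset_Int[of "nb a" "cset x"]
    card_mono[of "nb a" "nb a \<inter> cset x"] by (simp add: Int_commute)
qed

lemma insert_gap:
  assumes x: "lcyc x" and ps: "off x ps"
    and i: "adj (hd ps) (mu (x i))" and j: "adj (mu (last ps)) (x j)" and d: "1 \<le> d" "d \<le> int (length ps)"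
  shows "(i + d) mod int c \<noteq> j mod int c"
proof
  assume eq: "(i + d) mod int c = j mod int c"
  \<comment> \<open>\<open>insert_path\<close> covers at most one full turn, but \<open>d\<close>
    may exceed c; \<open>d'\<close> is its residue in the range from 1 to c, and it is at most
    \<open>d\<close>.\<close>
  define d' where "d' = (d - 1) mod int c + 1"
  have "(i + d') mod int c = (i + 1 + (d - 1) mod int c) mod int c" by (simp add: d'_def add_ac)
  also have "\<dots> = (i + d) mod int c" by (simp only: mod_add_right_eq) simp
  finally have "(i + d') mod int c = (i + d) mod int c" .
  then have "x (i + d') = x j" using eq lcyc_mod_eq[OF x] by metis
  moreover have "1 \<le> d'" "d' \<le> int c" using c_pos by (auto simp: d'_def) (smt (verit) pos_mod_bound of_nat_0_less_iff)
  ultimately have "int (length ps) < (i + d') - i"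
    using i j by (intro insert_path[OF x ps]) auto
  moreover have "d' \<le> d" using d c_pos by (auto simp: d'_def) (smt (verit) zmod_le_nonneg_dividend)
  ultimately show False using d by simp
qed

lemma IY_IX_gap:
  assumes x: "lcyc x" and ps: "off x ps" and i: "i \<in> IY x (hd ps)" and j: "j \<in> IX x (mu (last ps))"
    and d: "1 \<le> d" "d \<le> int (length ps)"
  shows "(i + d) mod int c \<noteq> j"
  using insert_gap[OF x ps _ _ d, of i j] i j by (auto simp: IX_def IY_def)

lemma IY_IX_card:
  assumes "lcyc x" "off x ps" "IY x (hd ps) \<noteq> {}" "IX x (mu (last ps)) \<noteq> {}"
  shows "card (IY x (hd ps)) + card (IX x (mu (last ps))) + length ps \<le> c + 1"
  using assms IY_IX_gap[OF assms(1,2)] off_not_Nil[OF assms(2)]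
  by (intro gap_count) (auto simp: Suc_le_eq)

lemma IY_IX_card_le:
  assumes "lcyc x" "off x ps"
  shows "card (IY x (hd ps)) + card (IX x (mu (last ps))) \<le> c"
  using IY_IX_gap[OF assms, of _ _ 1] off_not_Nil[OF assms(2)]
  by (intro shift_count) (auto simp: Suc_le_eq)

lemma IX_IY_card:
  assumes "lcyc x" "off x ps" "IX x (hd ps) \<noteq> {}" "IY x (mu (last ps)) \<noteq> {}"
  shows "card (IX x (hd ps)) + card (IY x (mu (last ps))) + length ps \<le> c + 1"
  using IY_IX_card[of x "rv ps"] assms off_not_Nil[OF assms(2)]
  by (simp add: hd_rv last_rv)

lemma IX_IY_card_le:
  assumes "lcyc x" "off x ps"
  shows "card (IX x (hd ps)) + card (IY x (mu (last ps))) \<le> c"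
  using IY_IX_card_le[of x "rv ps"] assms off_not_Nil[OF assms(2)]
  by (simp add: hd_rv last_rv)

lemma card_rev_index:
  assumes x: "lcyc x"
  shows "card (IX (\<lambda>i. mu (x (- i))) a) = card (IY x a)" "card (IY (\<lambda>i. mu (x (- i))) a) = card (IX x a)"
proof -
  have b: "bij_betw (\<lambda>i. (- i) mod int c) {i \<in> {0..<int c}. P (x (- i))} {i \<in> {0..<int c}. P (x i)}" for P
    using c_pos
    by (intro bij_betw_byWitness[where f' = "\<lambda>i. (- i) mod int c"])
      (auto simp: lcyc_mod[OF x] mod_simps lcyc_mod_minus[OF x])
  show "card (IX (\<lambda>i. mu (x (- i))) a) = card (IY x a)" "card (IY (\<lambda>i. mu (x (- i))) a) = card (IX x a)"
    using bij_betw_same_card[OF b[of "\<lambda>b. adj a (mu b)"]] bij_betw_same_card[OF b[of "\<lambda>b. adj a b"]]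
    by (simp_all add: IX_def IY_def)
qed

end

section \<open>Paths outside a longest cycle\<close>

lemma (in matched_graph) nth_vset: "i < length ps \<Longrightarrow> ps ! i \<in> vset ps"
  by (simp add: vset_mem_iff)

context longest_cycle
begin

definition maxoff :: "(int \<Rightarrow> 'a) \<Rightarrow> 'a list \<Rightarrow> bool" where
  "maxoff x ps \<longleftrightarrow> off x ps \<and> (\<forall>qs. off x qs \<longrightarrow> length qs \<le> length ps)"

lemma maxoff_rv [simp]: "maxoff x (rv ps) \<longleftrightarrow> maxoff x ps"
  by (simp add: maxoff_def)

lemma maxoff_rev_cycle [simp]: "maxoff (\<lambda>i. mu (x (- i))) ps \<longleftrightarrow> maxoff x ps"
  by (simp add: maxoff_def)

lemma off_same_vset:
  assumes "off x ps" "alt_path qs" "vset qs = vset ps"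
  shows "off x qs" "length qs = length ps"
  using assms card_vset[of ps] card_vset[of qs] by (auto simp: off_def)

lemma maxoff_same_vset:
  assumes "maxoff x ps" "alt_path qs" "vset qs = vset ps"
  shows "maxoff x qs" "length qs = length ps"
  using assms off_same_vset[of x ps qs] by (auto simp: maxoff_def)

lemma hd_vset: "ps \<noteq> [] \<Longrightarrow> hd ps \<in> vset ps"
  by (simp add: vset_mem_iff)

lemma last_vset: "ps \<noteq> [] \<Longrightarrow> mu (last ps) \<in> vset ps"
  by (simp add: vset_mem_iff)

lemma card_off_le:
  assumes x: "lcyc x" and ps: "off x ps"
  shows "c + length ps \<le> m"
proof -
  have "vset ps \<subseteq> V - cset x" using ps vset_subset_V by (auto simp: off_def)
  then have "card (vset ps) \<le> card (V - cset x)" using finite_V by (intro card_mono) auto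
  then show ?thesis using card_vset[of ps] ps card_rest[OF x] c_less_m by (auto simp: off_def)
qed

text \<open>A further neighbour outside C would let its matching edge be put in front of the
  path.\<close>

lemma nb_hd_maxoff:
  assumes ps: "maxoff x ps"
  shows "nb (hd ps) - cset x \<subseteq> vset ps"
proof
  fix w assume w: "w \<in> nb (hd ps) - cset x"
  show "w \<in> vset ps"
  proof (rule ccontr)
    assume "w \<notin> vset ps"
    with w ps have "off x ([mu w] @ ps)"
      using off_not_Nil[of x ps] nb_subset_V
      unfolding off_def maxoff_def by (subst alt_path_append) (auto simp: nb_def adj_commute intro: adj_V)
    then show False using ps by (auto simp: maxoff_def)
  qed
qed

text \<open>Positions are counted instead of vertices, because the crossing arguments compare one
  set of positions with another one shifted by 1.\<close>

definition du :: "'a list \<Rightarrow> 'a \<Rightarrow> nat" where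
  "du ps a = card {i. i < length ps \<and> adj a (ps ! i)}"

definition dv :: "'a list \<Rightarrow> 'a \<Rightarrow> nat" where
  "dv ps a = card {i. i < length ps \<and> adj a (mu (ps ! i))}"

lemma dv_le: "dv ps a \<le> length ps"
  using card_mono[of "{..<length ps}" "{i. i < length ps \<and> adj a (mu (ps ! i))}"] by (auto simp: dv_def)

lemma du_le: "du ps a \<le> length ps"
  using card_mono[of "{..<length ps}" "{i. i < length ps \<and> adj a (ps ! i)}"] by (auto simp: du_def)

lemma du_rv: "du (rv ps) a = dv ps a" and dv_rv: "dv (rv ps) a = du ps a"
proof -
  have n: "rv ps ! i = mu (ps ! (length ps - Suc i))" if "i < length ps" for i
    using that by (simp add: rv_def rev_nth)
  have b: "bij_betw (\<lambda>i. length ps - Suc i) {i. i < length ps \<and> P (ps ! (length ps - Suc i))}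
      {i. i < length ps \<and> P (ps ! i)}" for P
    by (intro bij_betw_byWitness[where f' = "\<lambda>i. length ps - Suc i"]) (auto simp: Suc_diff_Suc)
  have "{i. i < length ps \<and> adj a (rv ps ! i)} = {i. i < length ps \<and> adj a (mu (ps ! (length ps - Suc i)))}"
    "{i. i < length ps \<and> adj a (mu (rv ps ! i))} = {i. i < length ps \<and> adj a (ps ! (length ps - Suc i))}"
    using n by auto
  then show "du (rv ps) a = dv ps a" "dv (rv ps) a = du ps a"
    using bij_betw_same_card[OF b[of "\<lambda>b. adj a (mu b)"]] bij_betw_same_card[OF b[of "\<lambda>b. adj a b"]]
    by (simp_all add: du_def dv_def)
qed

lemma degree_in_path:
  assumes ps: "alt_path ps"
  shows "card (nb a \<inter> vset ps) = du ps a + dv ps a"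
proof -
  have d: "distinct ps" "set ps \<inter> mu ` set ps = {}" using ps by (auto simp: alt_path_def)
  let ?I = "{i. i < length ps \<and> adj a (ps ! i)}" and ?J = "{i. i < length ps \<and> adj a (mu (ps ! i))}"
  have eq: "nb a \<inter> vset ps = (!) ps ` ?I \<union> mu ` (!) ps ` ?J"
    by (auto simp: nb_def vset_def in_set_conv_nth image_iff)
  have inj: "inj_on ((!) ps) ?I" "inj_on ((!) ps) ?J" using d by (auto simp: inj_on_def nth_eq_iff_index_eq)
  have "(!) ps ` ?I \<inter> mu ` (!) ps ` ?J = {}" using d(2) nth_mem by fastforce
  then show ?thesis unfolding eq du_def dv_def using inj by (simp add: card_Un_disjoint card_image inj_mu)
qed

lemma degree_end:
  assumes x: "lcyc x" and ps: "maxoff x ps"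
  shows "card (nb (hd ps)) = card (IX x (hd ps)) + card (IY x (hd ps)) + du ps (hd ps) + dv ps (hd ps)"
proof -
  have "nb (hd ps) - cset x = nb (hd ps) \<inter> vset ps"
    using nb_hd_maxoff[OF ps] ps by (auto simp: maxoff_def off_def)
  then show ?thesis
    using degree_split[OF x] degree_in_path[of ps] ps by (simp add: maxoff_def off_def)
qed

lemma degree_end_ge:
  assumes x: "lcyc x" and ps: "maxoff x ps"
  shows "m \<le> card (IX x (hd ps)) + card (IY x (hd ps)) + du ps (hd ps) + dv ps (hd ps)"
proof -
  have "hd ps \<in> V" using hd_vset vset_subset_V ps by (auto simp: maxoff_def off_def alt_path_def)
  then show ?thesis using degree_end[OF assms] min_degree[of "hd ps"] by simp
qed

text \<open>By \<open>meet\<close> both ends are adjacent to a common \<open>x (i + 1)\<close>. The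
  mate of \<open>x i\<close> then has no neighbour on the path and few among the other mates, and
  its degree drops below m. \<open>D\<close> stands for the number of neighbours of both ends on the
  path.\<close>

lemma only_X_neighbours:
  assumes x: "lcyc x" and ps: "maxoff x ps" and p: "p = hd ps" and q: "q = mu (last ps)"
    and empty: "IY x p = {}" "IY x q = {}"
    and D: "2 * m \<le> card (IX x p) + card (IX x q) + D" "D < 4 * length ps"
    and meet: "c < card (IX x p) + card (IX x q)"
  shows False
proof -
  have off: "off x ps" using ps by (simp add: maxoff_def)
  define U where "U = IX x p \<union> IX x q"
  have finU: "finite U" "U \<subseteq> {0..<int c}" by (auto simp: U_def)
  have cU: "card U \<le> c" using card_mono[OF _ finU(2)] by simp
  have U_ge: "card (IX x p) + card (IX x q) \<le> 2 * card U"
    using card_mono[of U "IX x p"] card_mono[of U "IX x q"] finU by (auto simp: U_def)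
  have "IX x p \<inter> IX x q \<noteq> {}"
  proof
    assume "IX x p \<inter> IX x q = {}"
    then have "card U = card (IX x p) + card (IX x q)" by (simp add: U_def card_Un_disjoint)
    with meet cU show False by simp
  qed
  then obtain i where i: "adj p (x (i + 1))" "adj q (x (i + 1))"
    by (auto simp: IX_def) (metis diff_add_cancel)
  have q_rv: "q = hd (rv ps)" "p = mu (last (rv ps))" using off_not_Nil[OF off] by (auto simp: hd_rv last_rv p q)
  let ?y = "mu (x i)"
  \<comment> \<open>The mates whose successor on C is adjacent to neither end; \<open>chord\<close>
    excludes all others.\<close>
  let ?Z = "(\<lambda>j. mu (x (j - 1))) ` ({0..<int c} - U)"
  have "b \<in> x ` {0..<int c} \<union> ?Z \<union> (V - cset x - vset ps)" if b: "adj ?y b" for b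
  proof (cases "b \<in> cset x")
    case True
    then consider "b \<in> range x" | j where "b = mu (x j)" by (auto simp: cset_def)
    then show ?thesis
    proof cases
      case 1 then show ?thesis using lcyc_range[OF x] by simp
    next
      case (2 j)
      then have "x i \<noteq> x j" using b adj_irrefl by auto
      then have "\<not> adj q (x (j + 1))" "\<not> adj p (x (j + 1))"
        using chord[OF x off, of i j] chord[OF x off, of j i] b i 2 by (auto simp: p q adj_commute)
      then have "(j + 1) mod int c \<in> {0..<int c} - U"
        using c_pos lcyc_mod[OF x] by (auto simp: U_def IX_def)
      moreover have "mu (x ((j + 1) mod int c - 1)) = b"
        using lcyc_mod_eq[OF x, of "(j + 1) mod int c - 1" j] 2 by (simp add: mod_simps)
      ultimately show ?thesis by (intro UnI1 UnI2) (auto intro!: image_eqI[of b])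
    qed
  next
    case False
    have "b \<notin> vset ps"
    proof
      assume "b \<in> vset ps"
      then consider "b \<in> set ps" | "mu b \<in> set ps" by (auto simp: vset_mem_iff)
      then show False
      proof cases
        case 1
        then have "mu b \<in> set (rv ps)" by (auto simp: set_rv)
        then have "\<not> adj ?y (mu (mu b))"
          using off i q_rv by (intro chord_to_path[OF x, of "rv ps"]) auto
        then show False using b by simp
      next
        case 2
        then have "\<not> adj ?y (mu (mu b))"
          using off i p by (intro chord_to_path[OF x, of ps]) auto
        then show False using b by simp
      qed
    qed
    then show ?thesis using False adj_V2[OF b] by auto
  qed
  then have "nb ?y \<subseteq> x ` {0..<int c} \<union> ?Z \<union> (V - cset x - vset ps)" by (auto simp: nb_def)
  then have "card (nb ?y) \<le> card (x ` {0..<int c} \<union> ?Z \<union> (V - cset x - vset ps))"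
    using finite_V by (intro card_mono) auto
  also have "\<dots> \<le> card (x ` {0..<int c}) + card ?Z + card (V - cset x - vset ps)"
    by (rule order_trans[OF card_Un_le add_right_mono[OF card_Un_le]])
  also have "card (x ` {0..<int c}) \<le> c" using card_image_le[of "{0..<int c}" x] by simp
  also have "card ?Z \<le> c - card U"
    using card_image_le[of "{0..<int c} - U" "\<lambda>j. mu (x (j - 1))"] finU by (simp add: card_Diff_subset)
  also have "card (V - cset x - vset ps) = 2 * (m - c) - 2 * length ps"
  proof -
    have "vset ps \<subseteq> V - cset x" using off vset_subset_V by (auto simp: off_def)
    then show ?thesis using card_rest[OF x] card_vset[of ps] off by (simp add: card_Diff_subset off_def)
  qed
  finally have "card (nb ?y) \<le> c + (c - card U) + (2 * (m - c) - 2 * length ps)" by simp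
  moreover have "m \<le> card (nb ?y)" using lcycD(1)[OF x] by (intro min_degree) simp
  \<comment> \<open>The degree of \<open>?y\<close> gives
    \<open>card U \<le> m - 2 * length ps\<close>, whereas \<open>U_ge\<close> and \<open>D\<close>
    give the strict opposite.\<close>
  ultimately show False using D U_ge cU card_off_le[OF x off] by linarith
qed

text \<open>The classical crossing argument: if the head is adjacent to \<open>ps ! Suc i\<close>
  and the other end to the mate of \<open>ps ! i\<close>, the path can be reconnected into a cycle
  on the same vertices. So one position set avoids the shift of the other, and position 0 is in
  neither.\<close>

lemma du_end_sum:
  assumes ps: "alt_path ps" and ns: "\<nexists>qs. alt_cycle qs \<and> vset qs = vset ps"
  shows "du ps (hd ps) + dv ps (mu (last ps)) \<le> length ps - 1"
proof -
  let ?p = "hd ps" and ?q = "mu (last ps)" and ?k = "length ps"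
  have ne: "ps \<noteq> []" using ps alt_path_not_Nil by auto
  let ?I = "{i. i < ?k \<and> adj ?p (ps ! i)}" and ?J = "{i. i < ?k \<and> adj ?q (mu (ps ! i))}"
  have I: "?I \<subseteq> {1..<?k}" using ne adj_irrefl by (auto simp: hd_conv_nth Suc_le_eq intro!: gr0I)
  have J: "Suc ` ?J \<subseteq> {1..<?k}"
  proof -
    have "Suc i < ?k" if "i < ?k" "adj ?q (mu (ps ! i))" for i
      using that adj_irrefl ne by (cases "i = ?k - 1") (auto simp: last_conv_nth)
    then show ?thesis by auto
  qed
  have "\<not> adj ?q (mu (ps ! i))" if "Suc i < ?k" "adj ?p (ps ! Suc i)" for i
  proof
    assume a: "adj ?q (mu (ps ! i))"
    have r: "alt_path (take (Suc i) ps @ rv (drop (Suc i) ps))"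
      using rotate_last[OF ps, of "Suc i"] that a by simp
    have *: "vset (take (Suc i) ps @ rv (drop (Suc i) ps)) = vset ps"
      by (metis append_take_drop_id vset_append vset_rv)
    have "hd (take (Suc i) ps @ rv (drop (Suc i) ps)) = ?p" using ne by (simp add: hd_append)
    moreover have "mu (last (take (Suc i) ps @ rv (drop (Suc i) ps))) = ps ! Suc i"
      using that by (simp add: last_rv hd_drop_conv_nth)
    ultimately have "alt_cycle (take (Suc i) ps @ rv (drop (Suc i) ps))"
      using r that adj_sym unfolding alt_cycle_def by metis
    with ns * show False by blast
  qed
  then have dis: "?I \<inter> Suc ` ?J = {}" by auto
  have "du ps ?p + dv ps ?q = card (?I \<union> Suc ` ?J)"
    using dis by (simp add: du_def dv_def card_Un_disjoint card_image)
  also have "\<dots> \<le> card {1..<?k}" using I J by (intro card_mono) auto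
  finally show ?thesis by simp
qed

text \<open>A neighbour \<open>mu (ps ! i)\<close> of the head closes an initial part of the path
  into a cycle with \<open>i + 1\<close> matching edges.\<close>

lemma dv_hd_le:
  assumes ps: "alt_path ps"
  shows "dv ps (hd ps) \<le> c"
proof -
  have "Suc i \<le> c" if i: "i < length ps" "adj (hd ps) (mu (ps ! i))" for i
  proof -
    have ne: "take (Suc i) ps \<noteq> []" using i by auto
    have "alt_path (take (Suc i) ps)" using alt_path_appendD1[of "take (Suc i) ps" "drop (Suc i) ps"] ps ne by simp
    moreover have "hd (take (Suc i) ps) = hd ps" "last (take (Suc i) ps) = ps ! i"
      using i by (auto simp: take_Suc_conv_app_nth hd_append hd_conv_nth)
    ultimately have "alt_cycle (take (Suc i) ps)" using i by (simp add: alt_cycle_def adj_commute)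
    from longest[OF this] i show ?thesis by simp
  qed
  then have "{i. i < length ps \<and> adj (hd ps) (mu (ps ! i))} \<subseteq> {..<c}" by (auto simp: Suc_le_eq)
  then show ?thesis using card_mono[of "{..<c}"] by (fastforce simp: dv_def)
qed

lemma dv_hd_lt:
  assumes ps: "alt_path ps" and ns: "\<not> alt_cycle ps"
  shows "dv ps (hd ps) \<le> length ps - 1"
proof -
  have ne: "ps \<noteq> []" using ps alt_path_not_Nil by auto
  have "\<not> adj (hd ps) (mu (ps ! (length ps - 1)))"
    using ps ns ne by (simp add: alt_cycle_def last_conv_nth adj_commute)
  then have "i < length ps - 1" if "i < length ps" "adj (hd ps) (mu (ps ! i))" for i
    using that by (cases "i = length ps - 1") auto
  then have "{i. i < length ps \<and> adj (hd ps) (mu (ps ! i))} \<subseteq> {..<length ps - 1}" by auto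
  then show ?thesis using card_mono[of "{..<length ps - 1}"] by (fastforce simp: dv_def)
qed

text \<open>Without a closing, the crossing bound leaves so few neighbours on the path that both
  ends must see C, and both only the \<open>x i\<close> or both only the mates;
  \<open>only_X_neighbours\<close> excludes this.\<close>

lemma path_closes:
  assumes x: "lcyc x" and ps: "maxoff x ps"
  shows "\<exists>qs. alt_cycle qs \<and> vset qs = vset ps"
proof (rule ccontr)
  assume ns: "\<nexists>qs. alt_cycle qs \<and> vset qs = vset ps"
  define p q k where "p = hd ps" "q = mu (last ps)" "k = length ps"
  have off: "off x ps" and path: "alt_path ps" using ps by (auto simp: maxoff_def off_def)
  have ne: "ps \<noteq> []" using off off_not_Nil by auto
  have rvq: "hd (rv ps) = q" "mu (last (rv ps)) = p" using ne by (auto simp: hd_rv last_rv p_q_k_def)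
  have ckm: "c + k \<le> m" "1 \<le> k" using card_off_le[OF x off] ne by (auto simp: p_q_k_def Suc_le_eq)
  have s1: "du ps p + dv ps q \<le> k - 1" using du_end_sum[OF path ns] by (simp add: p_q_k_def)
  have nc: "\<not> alt_cycle ps" "\<not> alt_cycle (rv ps)" using ns vset_rv by auto
  have s2: "dv ps p \<le> c" "dv ps p \<le> k - 1" using dv_hd_le[OF path] dv_hd_lt[OF path nc(1)] by (auto simp: p_q_k_def)
  have s3: "du ps q \<le> c" "du ps q \<le> k - 1"
    using dv_hd_le[of "rv ps"] dv_hd_lt[of "rv ps"] path nc rvq by (auto simp: dv_rv p_q_k_def)
  have dp: "m \<le> card (IX x p) + card (IY x p) + du ps p + dv ps p"
    using degree_end_ge[OF x ps] by (simp add: p_q_k_def)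
  have dq: "m \<le> card (IX x q) + card (IY x q) + dv ps q + du ps q"
    using degree_end_ge[OF x, of "rv ps"] ps rvq by (simp add: du_rv dv_rv)
  have le: "card (IY x p) + card (IX x q) \<le> c" "card (IX x p) + card (IY x q) \<le> c"
    using IY_IX_card_le[OF x off] IX_IY_card_le[OF x off] by (auto simp: p_q_k_def)
  have gap1: "card (IY x p) + card (IX x q) + k \<le> c + 1" if "IY x p \<noteq> {}" "IX x q \<noteq> {}"
    using IY_IX_card[OF x off] that by (auto simp: p_q_k_def)
  have gap2: "card (IX x p) + card (IY x q) + k \<le> c + 1" if "IX x p \<noteq> {}" "IY x q \<noteq> {}"
    using IX_IY_card[OF x off] that by (auto simp: p_q_k_def)
  \<comment> \<open>If both sets were nonempty, one gap bound and \<open>le\<close> for the other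
    pair would bound the sum of the two degrees by 2(c + k - 1) < 2m.\<close>
  have e1: "IY x p = {} \<or> IX x q = {}" using gap1 le s1 s2 s3 dp dq ckm by (cases "IY x p = {} \<or> IX x q = {}") auto
  have e2: "IX x p = {} \<or> IY x q = {}" using gap2 le s1 s2 s3 dp dq ckm by (cases "IX x p = {} \<or> IY x q = {}") auto
  \<comment> \<open>An end without neighbours on C would have degree at most (k - 1) + c <
    m.\<close>
  have n1: "\<not> (IX x p = {} \<and> IY x p = {})" using dp s1 s2 ckm by auto
  have n2: "\<not> (IX x q = {} \<and> IY x q = {})" using dq s1 s3 ckm by auto
  define D where "D = du ps p + dv ps p + du ps q + dv ps q"
  \<comment> \<open>For the second inequality one of \<open>dv ps p\<close> and
    \<open>du ps q\<close> is bounded by c, the other by k - 1; it yields the premise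
    \<open>meet\<close> of \<open>only_X_neighbours\<close>.\<close>
  have D: "D < 4 * length ps" "D + c < 2 * m" using s1 s2 s3 ckm by (auto simp: D_def p_q_k_def)
  consider "IY x p = {}" "IY x q = {}" | "IX x p = {}" "IX x q = {}" using e1 e2 n1 n2 by blast
  then show False
  proof cases
    case 1
    then show ?thesis
      using only_X_neighbours[OF x ps p_q_k_def(1,2) 1, of D] D dp dq by (auto simp: D_def)
  next
    case 2
    let ?x = "\<lambda>i. mu (x (- i))"
    have eq: "card (IX ?x a) = card (IY x a)" "card (IY ?x a) = card (IX x a)" for a
      using card_rev_index[OF x] by auto
    have "IY ?x p = {}" "IY ?x q = {}" using 2 eq(2)[of p] eq(2)[of q] by (auto simp: card_eq_0_iff)
    then show ?thesis
      using only_X_neighbours[of ?x ps p q D] lcyc_rev[OF x] ps D dp dq 2 by (auto simp: D_def eq p_q_k_def)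
  qed
qed

end

section \<open>The rest is a single edge\<close>

lemma (in matched_graph) cycle_starting_at:
  assumes "alt_cycle ps" "w \<in> vset ps"
  obtains qs where "alt_cycle qs" "vset qs = vset ps" "hd qs = w"
proof -
  have *: "\<exists>qs. alt_cycle qs \<and> vset qs = vset ps \<and> hd qs = w" if "alt_cycle ps" "w \<in> set ps" for ps
  proof -
    obtain p1 p2 where "ps = p1 @ w # p2" using \<open>w \<in> set ps\<close> by (meson split_list)
    then show ?thesis using alt_cycle_rotate[of p1 "w # p2"] that(1) by (intro exI[of _ "(w # p2) @ p1"]) auto
  qed
  show thesis
  proof (cases "w \<in> set ps")
    case True
    then show ?thesis using * assms that by blast
  next
    case False
    then have "w \<in> set (rv ps)" using assms by (auto simp: vset_def set_rv)
    then show ?thesis using *[of "rv ps"] alt_cycle_rv[OF assms(1)] that by auto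
  qed
qed

text \<open>
  A longest path outside the cycle \<open>x\<close> whose vertex set \<open>W\<close> carries an alternating cycle: every
  spanning path of \<open>W\<close> is then also a longest path outside \<open>x\<close>, so every pair of its ends is subject
  to the gap bounds.
\<close>

locale closed_rest = longest_cycle +
  fixes x :: "int \<Rightarrow> 'a" and ps :: "'a list"
  assumes x: "lcyc x" and ps: "maxoff x ps" and cycle: "alt_cycle ps"
begin

abbreviation "W \<equiv> vset ps"
abbreviation "k \<equiv> length ps"

lemma k_le: "k \<le> c" "c + k \<le> m" "1 \<le> k"
  using longest[OF cycle] card_off_le[OF x, of ps] ps off_not_Nil[of x ps]
  by (auto simp: maxoff_def Suc_le_eq)

lemma card_W: "card W = 2 * k"
  using cycle card_vset by (simp add: alt_cycle_def)

lemma W_V: "W \<subseteq> V"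
  using cycle vset_subset_V by (simp add: alt_cycle_def)

lemma W_off: "W \<inter> cset x = {}"
  using ps by (simp add: maxoff_def off_def)

lemma nb_W: "w \<in> W \<Longrightarrow> nb w - cset x \<subseteq> W"
proof -
  assume "w \<in> W"
  then obtain qs where qs: "alt_cycle qs" "vset qs = W" "hd qs = w"
    using cycle_starting_at[OF cycle] by blast
  then have "maxoff x qs" using maxoff_same_vset(1)[OF ps] by (simp add: alt_cycle_def)
  then show ?thesis using nb_hd_maxoff qs by blast
qed

lemma degree_W: "w \<in> W \<Longrightarrow> m \<le> card (IX x w) + card (IY x w) + card (nb w \<inter> W)"
proof -
  assume w: "w \<in> W"
  then have "nb w - cset x = nb w \<inter> W" using nb_W W_off by blast
  then show ?thesis using degree_split[OF x, of w] min_degree[of w] w W_V by auto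
qed

lemma inner_degree: "w \<in> W \<Longrightarrow> card (nb w \<inter> W) \<le> 2 * k - 1"
proof -
  assume w: "w \<in> W"
  then have "nb w \<inter> W \<subseteq> W - {w}" using adj_irrefl by (auto simp: nb_def)
  then show ?thesis using card_mono[of "W - {w}" "nb w \<inter> W"] card_W w by simp
qed

lemma outer_degree: "w \<in> W \<Longrightarrow> c + 1 \<le> card (IX x w) + card (IY x w) + k"
  using degree_W[of w] inner_degree[of w] k_le by linarith

section \<open>Which sides of the cycle the vertices of W see\<close>

lemma off_spanning: "alt_path qs \<Longrightarrow> vset qs = W \<Longrightarrow> off x qs \<and> length qs = k"
  using off_same_vset[of x ps qs] ps by (simp add: maxoff_def)

lemma ends_W: "alt_path qs \<Longrightarrow> vset qs = W \<Longrightarrow> hd qs \<in> W \<and> mu (last qs) \<in> W"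
  using hd_vset last_vset alt_path_not_Nil by metis

text \<open>If the head sees only one side, it has at least c + 1 - k neighbours there, and a single
  neighbour of the other end on the opposite side already violates the gap bound.\<close>

lemma same_type1:
  assumes qs: "alt_path qs" "vset qs = W"
  shows "IX x (hd qs) = {} \<Longrightarrow> IX x (mu (last qs)) = {}" "IY x (hd qs) = {} \<Longrightarrow> IY x (mu (last qs)) = {}"
proof -
  have o: "off x qs" "length qs = k" using off_spanning[OF qs] by auto
  show "IX x (mu (last qs)) = {}" if "IX x (hd qs) = {}"
  proof (rule ccontr)
    assume ne: "IX x (mu (last qs)) \<noteq> {}"
    have d: "c + 1 \<le> card (IY x (hd qs)) + k" using outer_degree ends_W[OF qs] that by force
    then have "IY x (hd qs) \<noteq> {}" using k_le by auto
    moreover have "0 < card (IX x (mu (last qs)))" using ne by (simp add: card_gt_0_iff)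
    ultimately show False using IY_IX_card[OF x o(1) _ ne] d o(2) by simp
  qed
  show "IY x (mu (last qs)) = {}" if "IY x (hd qs) = {}"
  proof (rule ccontr)
    assume ne: "IY x (mu (last qs)) \<noteq> {}"
    have d: "c + 1 \<le> card (IX x (hd qs)) + k" using outer_degree ends_W[OF qs] that by force
    then have "IX x (hd qs) \<noteq> {}" using k_le by auto
    moreover have "0 < card (IY x (mu (last qs)))" using ne by (simp add: card_gt_0_iff)
    ultimately show False using IX_IY_card[OF x o(1) _ ne] d o(2) by simp
  qed
qed

lemma same_type:
  assumes qs: "alt_path qs" "vset qs = W"
  shows "IX x (hd qs) = {} \<longleftrightarrow> IX x (mu (last qs)) = {}" "IY x (hd qs) = {} \<longleftrightarrow> IY x (mu (last qs)) = {}"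
  using same_type1[OF qs] same_type1[of "rv qs"] qs alt_path_not_Nil[OF qs(1)]
  by (auto simp: hd_rv last_rv)

lemma not_both_empty: "w \<in> W \<Longrightarrow> IX x w \<noteq> {} \<or> IY x w \<noteq> {}"
  using outer_degree k_le by fastforce

text \<open>Otherwise the c < m vertices \<open>x i\<close> would separate W from the mates.\<close>

lemma some_Y: "\<exists>w\<in>W. IY x w \<noteq> {}"
proof (rule ccontr)
  assume "\<not> ?thesis"
  then have e: "IY x w = {}" if "w \<in> W" for w using that by blast
  have "card (range x) < m"
    using card_image_le[of "{0..<int c}" x] lcyc_range[OF x] c_less_m by simp
  moreover have "mu (x 0) \<in> V - range x - W"
    using lcycD[OF x] W_off by (auto simp: disjoint_iff) (metis cset_mem)
  moreover have "W \<inter> range x = {}" using W_off by (auto simp: cset_def)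
  moreover have "W \<noteq> {}" using card_W k_le by auto
  moreover have "range x \<subseteq> V" using lcycD(1)[OF x] by blast
  ultimately have "\<exists>a\<in>W. \<exists>b\<in>V - range x - W. adj a b"
    using W_V by (intro separation[of "range x"]) blast+
  then obtain a b where ab: "a \<in> W" "b \<notin> range x" "b \<notin> W" "adj a b" by auto
  then have "b \<in> cset x" using nb_W[of a] by (auto simp: nb_def)
  then obtain j where "b = mu (x j)" using ab by (auto simp: cset_def)
  then have "j mod int c \<in> IY x a" using ab c_pos lcyc_mod[OF x] by (simp add: IY_def)
  with e[OF ab(1)] show False by auto
qed

lemma some_X: "\<exists>w\<in>W. IX x w \<noteq> {}"
proof -
  interpret r: closed_rest V adj mu m c "\<lambda>i. mu (x (- i))" ps
    using lcyc_rev[OF x] ps cycle by unfold_locales auto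
  obtain w where "w \<in> W" "card (IY (\<lambda>i. mu (x (- i))) w) \<noteq> 0" using r.some_Y by auto
  then show ?thesis using card_rev_index[OF x, of w] by (auto intro!: bexI[of _ w])
qed

text \<open>Both gap bounds apply here; together with at most 2k - 1 neighbours inside W for each
  end they just reach the required 2m, so all are attained.\<close>

lemma tight:
  assumes qs: "alt_path qs" "vset qs = W"
    and ne: "IX x (hd qs) \<noteq> {}" "IY x (hd qs) \<noteq> {}"
  shows "card (IY x (hd qs)) + card (IX x (mu (last qs))) + k = c + 1"
    "card (IX x (hd qs)) + card (IY x (mu (last qs))) + k = c + 1"
    "W - {hd qs} \<subseteq> nb (hd qs)" "W - {mu (last qs)} \<subseteq> nb (mu (last qs))"
proof -
  let ?p = "hd qs" and ?q = "mu (last qs)"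
  have o: "off x qs" "length qs = k" using off_spanning[OF qs] by auto
  have W: "?p \<in> W" "?q \<in> W" using ends_W[OF qs] by auto
  have ne': "IX x ?q \<noteq> {}" "IY x ?q \<noteq> {}" using ne same_type[OF qs] by auto
  have 1: "card (IY x ?p) + card (IX x ?q) + k \<le> c + 1" "card (IX x ?p) + card (IY x ?q) + k \<le> c + 1"
    using IY_IX_card[OF x o(1)] IX_IY_card[OF x o(1)] ne ne' o(2) by auto
  note deg = degree_W[OF W(1)] inner_degree[OF W(1)] degree_W[OF W(2)] inner_degree[OF W(2)]
  show "card (IY x ?p) + card (IX x ?q) + k = c + 1" "card (IX x ?p) + card (IY x ?q) + k = c + 1"
    using 1 deg k_le by linarith+
  have full: "W - {w} \<subseteq> nb w" if "w \<in> W" "2 * k - 1 \<le> card (nb w \<inter> W)" for w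
  proof -
    have "nb w \<inter> W \<subseteq> W - {w}" using adj_irrefl by (auto simp: nb_def)
    then have "nb w \<inter> W = W - {w}" using that card_W by (intro card_subset_eq card_seteq) auto
    then show ?thesis by blast
  qed
  show "W - {?p} \<subseteq> nb ?p" "W - {?q} \<subseteq> nb ?q"
    using 1 deg k_le by (intro full W; linarith)+
qed

text \<open>From \<open>p\<close> and from \<open>mu p\<close> there are tight spanning paths to the
  same end \<open>q\<close>, and the equalities force \<open>p\<close> and \<open>mu p\<close> to
  have the same neighbours on C. These forbid so many indices to the other vertices of W that the
  neighbours of W on C form too small a cut.\<close>

lemma no_mixed_vertex:
  assumes k2: "2 \<le> k" and p: "p \<in> W"
  shows "IX x p = {} \<or> IY x p = {}"
proof (rule ccontr)
  assume "\<not> ?thesis"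
  then have ne: "IX x p \<noteq> {}" "IY x p \<noteq> {}" by auto
  obtain qs where qs: "alt_cycle qs" "vset qs = W" "hd qs = p"
    using cycle_starting_at[OF cycle p] by blast
  define q where "q = mu (last qs)"
  have path: "alt_path qs" and qs_ne: "qs \<noteq> []" using qs alt_path_not_Nil by (auto simp: alt_cycle_def)
  have len: "length qs = k" "off x qs" using off_spanning[OF path qs(2)] by auto
  note t = tight[OF path qs(2), unfolded qs(3), OF ne, folded q_def]
  \<comment> \<open>The first matching edge reversed: a spanning path from \<open>mu p\<close> to
    the same \<open>q\<close>. It relies on a second entry \<open>qs ! 1\<close>, hence on
    \<open>k2\<close>.\<close>
  define rs where "rs = rv (take 1 qs) @ drop 1 qs"
  have qs1: "take 1 qs = [p]" using qs_ne qs(3) by (cases qs) auto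
  have rs: "alt_path rs" "vset rs = W" "hd rs = mu p" "mu (last rs) = q"
  proof -
    have "adj p (qs ! 1)"
    proof -
      have "qs ! 1 \<noteq> hd qs"
      proof -
        have "1 < length qs" "0 < length qs" using k2 len by linarith+
        then show ?thesis
          using path qs_ne nth_eq_iff_index_eq[of qs 1 0] unfolding alt_path_def by (metis hd_conv_nth zero_neq_one)
      qed
      then show ?thesis using t(3) nth_vset[of 1 qs] qs k2 len by (auto simp: nb_def)
    qed
    then show "alt_path rs" unfolding rs_def using rotate_hd[OF path, of 1] k2 len qs by simp
    show "vset rs = W" unfolding rs_def using qs(2) by (metis append_take_drop_id vset_append vset_rv)
    show "hd rs = mu p" unfolding rs_def qs1 by simp
    show "mu (last rs) = q" using k2 len by (auto simp: rs_def q_def)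
  qed
  have q_ne: "IX x q \<noteq> {}" "IY x q \<noteq> {}" using same_type[OF path qs(2)] ne qs(3) q_def by auto
  have mup_ne: "IX x (mu p) \<noteq> {}" "IY x (mu p) \<noteq> {}" using same_type[OF rs(1,2)] q_ne rs(3,4) by auto
  note t' = tight[OF rs(1,2), unfolded rs(3,4), OF mup_ne]
  have offs: "off x rs" "length rs = k" using off_spanning[OF rs(1,2)] by auto
  \<comment> \<open>The union of the two sets still obeys the gap bound against
    \<open>IX x q\<close>, in which each of them alone attains equality.\<close>
  have IY_eq: "IY x p = IY x (mu p)"
  proof -
    have "(i + d) mod int c \<noteq> j"
      if "i \<in> IY x p \<union> IY x (mu p)" "j \<in> IX x q" "1 \<le> d" "d \<le> int k" for i j d
      using IY_IX_gap[OF x len(2), of i j d] IY_IX_gap[OF x offs(1), of i j d] that len offs qs(3) rs(3,4)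
      by (auto simp: q_def)
    then have "card (IY x p \<union> IY x (mu p)) + card (IX x q) + k \<le> c + 1"
      using ne q_ne k_le by (intro gap_count) auto
    then have u: "card (IY x p \<union> IY x (mu p)) \<le> card (IY x p)" "card (IY x p \<union> IY x (mu p)) \<le> card (IY x (mu p))"
      using t(1) t'(1) by linarith+
    have "IY x p = IY x p \<union> IY x (mu p)" using u by (intro card_seteq) auto
    moreover have "IY x (mu p) = IY x p \<union> IY x (mu p)" using u by (intro card_seteq) auto
    ultimately show ?thesis by simp
  qed
  have IX_eq: "IX x p = IX x (mu p)"
  proof -
    have e: "hd (rv qs) = q" "mu (last (rv qs)) = p" "hd (rv rs) = q" "mu (last (rv rs)) = mu p"
      using qs(3) rs(3,4) qs_ne alt_path_not_Nil[OF rs(1)] by (auto simp: hd_rv last_rv q_def)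
    have "(i + d) mod int c \<noteq> j"
      if "i \<in> IY x q" "j \<in> IX x p \<union> IX x (mu p)" "1 \<le> d" "d \<le> int k" for i j d
      using IY_IX_gap[OF x, of "rv qs" i j d] IY_IX_gap[OF x, of "rv rs" i j d] that e len offs by auto
    then have "card (IY x q) + card (IX x p \<union> IX x (mu p)) + k \<le> c + 1"
      using ne q_ne k_le by (intro gap_count) auto
    then have u: "card (IX x p \<union> IX x (mu p)) \<le> card (IX x p)" "card (IX x p \<union> IX x (mu p)) \<le> card (IX x (mu p))"
      using t(2) t'(2) by linarith+
    have "IX x p = IX x p \<union> IX x (mu p)" using u by (intro card_seteq) auto
    moreover have "IX x (mu p) = IX x p \<union> IX x (mu p)" using u by (intro card_seteq) auto
    ultimately show ?thesis by simp
  qed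
  \<comment> \<open>A mate in \<open>qs\<close> is reached by an initial part, an entry by a
    rotation at the end \<open>q\<close>, which by \<open>tight\<close> is adjacent to all of
    W.\<close>
  have reach: "\<exists>r. off x r \<and> hd r = p \<and> mu (last r) = w" if w: "w \<in> W" "w \<noteq> p" for w
  proof -
    have "w \<in> vset qs" using w qs by simp
    then consider i where "i < length qs" "w = mu (qs ! i)" | i where "i < length qs" "w = qs ! i"
      unfolding vset_def by (auto simp: in_set_conv_nth)
    then show ?thesis
    proof cases
      case 1
      have e: "take (Suc i) qs \<noteq> []" using qs_ne by simp
      have "vset (take (Suc i) qs) \<subseteq> vset qs" by (metis append_take_drop_id vset_append Un_upper1)
      then have "off x (take (Suc i) qs)"
        using alt_path_appendD1[of "take (Suc i) qs" "drop (Suc i) qs"] path e len(2) by (auto simp: off_def)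
      moreover have "mu (last (take (Suc i) qs)) = w" using 1 by (simp add: take_Suc_conv_app_nth)
      ultimately show ?thesis using qs(3) by (intro exI[of _ "take (Suc i) qs"]) simp
    next
      case 2
      then have i: "0 < i" using w(2) qs(3) qs_ne by (cases i) (auto simp: hd_conv_nth)
      have "qs ! (i - 1) \<noteq> last qs"
        using path i 2(1) qs_ne by (auto simp: last_conv_nth alt_path_def nth_eq_iff_index_eq)
      moreover have "mu (qs ! (i - 1)) \<in> W" using nth_vset[of "i - 1" qs] 2(1) qs(2) by simp
      ultimately have "mu (qs ! (i - 1)) \<in> W - {q}" by (simp add: q_def)
      then have "mu (qs ! (i - 1)) \<in> nb q" using t(4) by blast
      then have "adj q (mu (qs ! (i - 1)))" by (simp add: nb_def)
      then have "alt_path (take i qs @ rv (drop i qs))" using rotate_last[OF path i 2(1)] by (simp add: q_def)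
      moreover have "vset (take i qs @ rv (drop i qs)) = W"
        by (metis append_take_drop_id vset_append vset_rv qs(2))
      moreover have "hd (take i qs @ rv (drop i qs)) = p" using qs(3) i qs_ne by (simp add: hd_append)
      moreover have "mu (last (take i qs @ rv (drop i qs))) = w" using 2 by (simp add: last_rv hd_drop_conv_nth)
      ultimately show ?thesis using off_spanning by blast
    qed
  qed
  define A where "A = (\<Union>w\<in>W. IY x w)"
  define B where "B = (\<Union>w\<in>W. IX x w)"
  have AB: "A \<subseteq> {0..<int c}" "B \<subseteq> {0..<int c}" using IX_IY by (auto simp: A_def B_def IX_def IY_def)
  have single: "off x [p]" "off x [mu p]" using p W_V W_off by (auto simp: off_def)
  \<comment> \<open>The paths from \<open>reach\<close> may be short, so only the gap 1 is
    available. For \<open>w = p\<close> the single matching edge of \<open>p\<close> serves, thanks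
    to \<open>IY_eq\<close>.\<close>
  have gapA: "(i + 1) mod int c \<noteq> j" if ij: "i \<in> IY x w" "w \<in> W" "j \<in> IX x p" for i j w
  proof (cases "w = p")
    case True
    then show ?thesis using IY_IX_gap[OF x single(2), of i j 1] ij IY_eq by simp
  next
    case False
    then obtain r where r: "off x r" "hd r = p" "mu (last r) = w" using reach ij by blast
    then have "off x (rv r)" "hd (rv r) = w" "mu (last (rv r)) = p" "1 \<le> length (rv r)"
      using off_not_Nil[OF r(1)] by (auto simp: hd_rv last_rv Suc_le_eq)
    then show ?thesis using IY_IX_gap[OF x, of "rv r" i j 1] ij by simp
  qed
  have gapB: "(i + 1) mod int c \<noteq> j" if ij: "i \<in> IY x p" "w \<in> W" "j \<in> IX x w" for i j w
  proof (cases "w = p")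
    case True
    then show ?thesis using IY_IX_gap[OF x single(1), of i j 1] ij IX_eq by simp
  next
    case False
    then obtain r where r: "off x r" "hd r = p" "mu (last r) = w" using reach ij by blast
    moreover have "1 \<le> length r" using off_not_Nil[OF r(1)] by (simp add: Suc_le_eq)
    ultimately show ?thesis using IY_IX_gap[OF x, of r i j 1] ij by simp
  qed
  have "(i + 1) mod int c \<noteq> j" if "i \<in> A" "j \<in> IX x p" for i j
    using that gapA unfolding A_def by blast
  then have cA: "card A + card (IX x p) \<le> c" using AB by (intro shift_count) auto
  have "(i + 1) mod int c \<noteq> j" if "i \<in> IY x p" "j \<in> B" for i j
    using that gapB unfolding B_def by blast
  then have cB: "card (IY x p) + card B \<le> c" using AB by (intro shift_count) auto
  define S where "S = x ` B \<union> mu ` x ` A"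
  have "finite A" "finite B" using AB finite_subset by blast+
  then have "card (x ` B) \<le> card B" "card (mu ` x ` A) \<le> card A"
    by (auto intro: card_image_le order_trans[OF card_image_le])
  moreover have "card S \<le> card (x ` B) + card (mu ` x ` A)" unfolding S_def by (rule card_Un_le)
  \<comment> \<open>\<open>cA\<close> and \<open>cB\<close> bound \<open>card S\<close> by 2c minus
    the number of neighbours of \<open>p\<close> on C, which is at least m - (2k - 1).\<close>
  ultimately have S: "card S + m < 2 * c + 2 * k" using cA cB degree_W[OF p] inner_degree[OF p] k_le by linarith
  have S_sub: "S \<subseteq> cset x" by (auto simp: S_def cset_def)
  have "\<exists>a\<in>W. \<exists>b\<in>V - S - W. adj a b"
  proof (rule separation[of S])
    show "S \<subseteq> V" using S_sub cset_subset_V[OF x] by blast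
    show "card S < m" using S k_le by linarith
    show "W \<union> (V - S - W) = V - S" using W_V W_off S_sub by blast
    show "V - S - W \<noteq> {}"
    proof
      assume "V - S - W = {}"
      then have "card V \<le> card (S \<union> W)"
        using S_sub finite_cset[OF x] by (intro card_mono) (auto intro: finite_subset)
      also have "\<dots> \<le> card S + card W" by (rule card_Un_le)
      finally show False using card_V card_W S k_le by linarith
    qed
  qed (use p in auto)
  then obtain a b where ab: "a \<in> W" "adj a b" "b \<notin> S" "b \<notin> W" by auto
  then have "b \<in> cset x" using nb_W[of a] by (auto simp: nb_def)
  then consider j where "b = x j" | j where "b = mu (x j)" by (auto simp: cset_def)
  then have "b \<in> S"
  proof cases
    case 1
    then have "j mod int c \<in> B" using ab c_pos lcyc_mod[OF x] by (auto simp: B_def IX_def)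
    then show ?thesis using 1 lcyc_mod[OF x, of j] by (auto simp: S_def image_iff) metis
  next
    case 2
    then have "j mod int c \<in> A" using ab c_pos lcyc_mod[OF x] by (auto simp: A_def IY_def)
    then show ?thesis using 2 lcyc_mod[OF x, of j] by (auto simp: S_def image_iff) metis
  qed
  with ab show False by simp
qed

text \<open>A crossing argument for \<open>p\<close> and \<open>mu p\<close>, in which a crossing
  produces not a cycle but a vertex of W without neighbours on C.\<close>

lemma no_mixed_edge:
  assumes p: "p \<in> W" and e: "IY x p = {}" "IX x (mu p) = {}"
  shows False
proof -
  obtain qs where qs: "alt_cycle qs" "vset qs = W" "hd qs = p"
    using cycle_starting_at[OF cycle p] by blast
  define q where "q = mu (last qs)"
  have path: "alt_path qs" and qs_ne: "qs \<noteq> []" using qs alt_path_not_Nil by (auto simp: alt_cycle_def)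
  have len: "length qs = k" using off_spanning[OF path qs(2)] by auto
  have eq: "IY x q = {}" using same_type[OF path qs(2)] e qs q_def by simp
  have mup: "mu p \<in> W" using p by simp
  have qs_Cons: "qs = p # tl qs" using qs_ne qs(3) by (cases qs) auto
  \<comment> \<open>Moving \<open>p\<close> to the end of the cycle makes \<open>mu p\<close> an end
    of the spanning path, so that \<open>IX x (mu p) = {}\<close> can be passed on.\<close>
  let ?rs = "tl qs @ [p]"
  have rs: "alt_cycle ?rs" "vset ?rs = W"
  proof -
    show "alt_cycle ?rs" using alt_cycle_rotate[of "[p]" "tl qs"] qs(1) qs_Cons by simp
    show "vset ?rs = W" by (metis append_Cons append_Nil vset_append qs_Cons qs(2) Un_commute)
  qed
  have rs_path: "alt_path ?rs" using rs(1) by (simp add: alt_cycle_def)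
  have rs_nth: "?rs ! i = qs ! Suc i" if "Suc i < k" for i
  proof -
    have "i < length (tl qs)" using that len by simp
    then show ?thesis by (simp add: nth_append nth_tl)
  qed
  have hd_rs: "IX x (hd ?rs) = {}" using same_type[OF rs_path rs(2)] e by simp
  \<comment> \<open>The emptiness of \<open>IY\<close> passes from \<open>q\<close> to
    \<open>mu (qs ! (i - 1))\<close>, the other end of \<open>?a\<close>, and from there to
    \<open>qs ! i\<close>, the other end of \<open>?b\<close>.\<close>
  have u: "IY x (qs ! i) = {}" if i: "0 < i" "i < k" "adj p (qs ! i)" for i
  proof -
    let ?a = "rv (take i qs) @ drop i qs"
    have "alt_path ?a" using rotate_hd[OF path] i len qs by simp
    moreover have "vset ?a = W" by (metis append_take_drop_id vset_append vset_rv qs(2))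
    moreover have "hd ?a = mu (qs ! (i - 1))"
      using i len qs_ne by (auto simp: hd_append hd_rv last_conv_nth)
    moreover have "mu (last ?a) = q" using i len by (simp add: q_def)
    ultimately have 1: "IY x (mu (qs ! (i - 1))) = {}" using same_type(2)[of ?a] eq by simp
    let ?b = "drop i qs @ take i qs"
    have "alt_path ?b" using alt_cycle_rotate[of "take i qs" "drop i qs"] qs(1) by (simp add: alt_cycle_def)
    moreover have "vset ?b = W" by (metis append_take_drop_id vset_append Un_commute qs(2))
    moreover have "last (take i qs) = qs ! (i - 1)" using i len qs_ne by (simp add: last_conv_nth)
    then have "hd ?b = qs ! i" "mu (last ?b) = mu (qs ! (i - 1))"
      using i len qs_ne by (auto simp: hd_append hd_drop_conv_nth)
    ultimately show ?thesis using same_type(2)[of ?b] 1 by simp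
  qed
  have v: "IX x (?rs ! i) = {}" if i: "0 < i" "i < k" "adj (mu p) (mu (qs ! i))" for i
  proof -
    let ?a = "take i ?rs @ rv (drop i ?rs)"
    have "?rs ! (i - 1) = qs ! i" using rs_nth[of "i - 1"] i by simp
    then have "alt_path ?a" using rotate_last[OF rs_path, of i] i len by simp
    moreover have "vset ?a = W" by (metis append_take_drop_id vset_append vset_rv rs(2))
    moreover have "tl qs \<noteq> []" using i len by (cases qs) auto
    then have "hd ?a = hd ?rs" "mu (last ?a) = ?rs ! i"
      using i len qs_ne by (auto simp: hd_append last_rv hd_drop_conv_nth hd_conv_nth nth_append)
    ultimately show ?thesis using same_type(1)[of ?a] hd_rs by simp
  qed
  let ?I = "{i. i < length qs \<and> adj p (qs ! i)}" and ?J = "{i. i < length qs \<and> adj (mu p) (mu (qs ! i))}"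
  have q0: "qs ! 0 = p" using qs_ne qs(3) by (simp add: hd_conv_nth)
  have I: "?I \<subseteq> {1..<k}" using q0 len adj_irrefl by (auto simp: Suc_le_eq intro!: gr0I)
  have J_pos: "0 < i" if "i \<in> ?J" for i using that q0 adj_irrefl by (cases i) auto
  have J_lt: "Suc i < k" if i: "i \<in> ?J" for i
  proof (rule ccontr)
    assume "\<not> Suc i < k"
    then have "i = k - 1" using i len by auto
    then have "?rs ! i = p" using len by (simp add: nth_append)
    then have "IX x p = {}" using v[of i] J_pos[OF i] i len by simp
    with e(1) not_both_empty[OF p] show False by simp
  qed
  have J: "Suc ` ?J \<subseteq> {1..<k}" using J_lt by auto
  have dis: "?I \<inter> Suc ` ?J = {}"
  proof -
    have False if i: "Suc i \<in> ?I" "i \<in> ?J" for i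
    proof -
      have "IY x (qs ! Suc i) = {}" using u[of "Suc i"] i len by simp
      moreover have "IX x (qs ! Suc i) = {}" using v[of i] J_pos[OF i(2)] i(2) len rs_nth[OF J_lt[OF i(2)]] by simp
      moreover have "qs ! Suc i \<in> W" using nth_vset[of "Suc i" qs] i qs(2) by simp
      ultimately show False using not_both_empty by blast
    qed
    then show ?thesis by blast
  qed
  have "du qs p + dv qs (mu p) = card (?I \<union> Suc ` ?J)"
    using dis by (simp add: du_def dv_def card_Un_disjoint card_image)
  also have "\<dots> \<le> card {1..<k}" using I J by (intro card_mono) auto
  finally have "du qs p + dv qs (mu p) \<le> k - 1" by simp
  moreover have "dv qs p \<le> k" "du qs (mu p) \<le> k" using dv_le du_le len by metis+
  moreover have "off x [p]" using p W_V W_off by (auto simp: off_def)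
  then have "card (IX x p) + card (IY x (mu p)) \<le> c" using IX_IY_card_le[OF x, of "[p]"] by simp
  moreover have "m \<le> card (IX x p) + card (IY x p) + (du qs p + dv qs p)"
    "m \<le> card (IX x (mu p)) + card (IY x (mu p)) + (du qs (mu p) + dv qs (mu p))"
    using degree_W[OF p] degree_W[OF mup] degree_in_path[OF path] qs(2) by auto
  \<comment> \<open>The degrees of \<open>p\<close> and \<open>mu p\<close> sum to at most c + (k -
    1) + 2k, which is less than 2(c + k) because k \<le> c.\<close>
  ultimately show False using k_le e by simp
qed

text \<open>For k \<ge> 2 each vertex of W sees exactly one side of C. Mates agree by
  \<open>no_mixed_edge\<close>, and consecutive edges of the cycle agree because they provide the
  ends of a spanning path; so all of W sees the same side, against \<open>some_X\<close> and
  \<open>some_Y\<close>.\<close>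

lemma rest_single: "k = 1"
proof (rule ccontr)
  assume "k \<noteq> 1"
  then have k2: "2 \<le> k" using k_le by linarith
  have path: "alt_path ps" and ne: "ps \<noteq> []" using cycle alt_path_not_Nil by (auto simp: alt_cycle_def)
  have type: "IX x w = {} \<longleftrightarrow> IY x w \<noteq> {}" if "w \<in> W" for w
    using no_mixed_vertex[OF k2 that] not_both_empty[OF that] by blast
  have mate: "IX x (mu w) = {} \<longleftrightarrow> IX x w = {}" if "w \<in> W" for w
    using no_mixed_edge[of w] no_mixed_edge[of "mu w"] type[of w] type[of "mu w"] that by auto
  have "IX x (ps ! i) = {} \<longleftrightarrow> IX x (ps ! 0) = {}" if "i < k" for i
    using that
  proof (induction i)
    case (Suc i)
    let ?b = "drop (Suc i) ps @ take (Suc i) ps"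
    have "alt_path ?b" using alt_cycle_rotate[of "take (Suc i) ps" "drop (Suc i) ps"] cycle by (simp add: alt_cycle_def)
    moreover have "vset ?b = W" by (metis append_take_drop_id vset_append Un_commute)
    moreover have "hd ?b = ps ! Suc i" "mu (last ?b) = mu (ps ! i)"
      using Suc.prems by (auto simp: hd_drop_conv_nth take_Suc_conv_app_nth hd_append)
    ultimately have "IX x (ps ! Suc i) = {} \<longleftrightarrow> IX x (mu (ps ! i)) = {}" using same_type(1)[of ?b] by simp
    then show ?case using Suc mate[of "ps ! i"] nth_vset[of i ps] by simp
  qed simp
  then have "IX x w = {} \<longleftrightarrow> IX x (ps ! 0) = {}" if w: "w \<in> W" for w
  proof -
    consider i where "i < k" "w = ps ! i" | i where "i < k" "w = mu (ps ! i)"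
      using w unfolding vset_def by (auto simp: in_set_conv_nth)
    then show ?thesis using \<open>\<And>i. i < k \<Longrightarrow> _\<close> mate[of "ps ! i" for i] nth_vset by cases auto
  qed
  then show False using some_X some_Y type by metis
qed

end

context longest_cycle
begin

lemma obtain_lcyc:
  assumes "alt_cycle xs" "length xs = c"
  obtains x where "lcyc x"
  using lcyc_of_list[OF assms] by blast

text \<open>The two ends of the remaining edge have at most 2c neighbours on C and one each in W, so
  2m \<le> 2c + 2.\<close>

lemma omitted_single:
  assumes x: "lcyc x"
  shows "m = c + 1"
proof -
  obtain a where a: "a \<in> V - cset x"
    using card_rest[OF x] c_less_m by (metis card.empty ex_in_conv mult_is_0 zero_neq_numeral diff_is_0_eq leD)
  then have o: "off x [a]" by (auto simp: off_def)
  have "\<exists>ps. maxoff x ps"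
  proof -
    have "\<forall>qs. off x qs \<longrightarrow> length qs < Suc m" using card_off_le[OF x] by fastforce
    from ex_has_greatest_nat[of "off x", OF o this] show ?thesis unfolding maxoff_def by blast
  qed
  then obtain ps where ps: "maxoff x ps" by blast
  obtain qs where qs: "alt_cycle qs" "vset qs = vset ps" using path_closes[OF x ps] by blast
  then have "maxoff x qs" using maxoff_same_vset(1)[OF ps] by (simp add: alt_cycle_def)
  then interpret closed_rest V adj mu m c x qs using x qs by unfold_locales
  have "hd qs \<in> vset qs" using hd_vset qs(1) alt_path_not_Nil by (auto simp: alt_cycle_def)
  note p = this
  then have "off x [hd qs]" using W_V W_off by (auto simp: off_def)
  then have le: "card (IX x (hd qs)) + card (IY x (mu (hd qs))) \<le> c" "card (IY x (hd qs)) + card (IX x (mu (hd qs))) \<le> c"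
    using IX_IY_card_le[OF x, of "[hd qs]"] IY_IX_card_le[OF x, of "[hd qs]"] by auto
  have "2 * m \<le> 2 * c + 2"
    using degree_W[OF p] inner_degree[OF p] degree_W[of "mu (hd qs)"] inner_degree[of "mu (hd qs)"] p rest_single le
    by simp
  then show ?thesis using c_less_m by linarith
qed

end

section \<open>The extremal case\<close>

locale omitted = longest_cycle +
  fixes x :: "int \<Rightarrow> 'a" and u :: 'a
  assumes x: "lcyc x" and u_V: "u \<in> V" and u_off: "u \<notin> cset x"
begin

abbreviation "v \<equiv> mu u"
abbreviation "y i \<equiv> mu (x i)"

text \<open>
  By \<open>adj_v_x\<close> and \<open>adj_v_y\<close> below, \<open>au i\<close> and \<open>bu i\<close> also determine the adjacency of \<open>v\<close> to both ends
  of the edge from \<open>y i\<close> to \<open>x (i + 1)\<close>.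
\<close>

definition au :: "int \<Rightarrow> bool" where "au i \<longleftrightarrow> adj u (y i)"
definition bu :: "int \<Rightarrow> bool" where "bu i \<longleftrightarrow> adj u (x (i + 1))"

lemma m_eq: "m = c + 1"
  using omitted_single[OF x] .

lemma off_u: "off x [u]" "off x [v]"
  using u_V u_off by (auto simp: off_def)

lemma V_eq: "V = cset x \<union> {u, v}"
proof -
  have "card (V - cset x) = 2" using card_rest[OF x] m_eq by simp
  moreover have "{u, v} \<subseteq> V - cset x" "card {u, v} = 2" using u_V u_off mu_neq[of u] by auto
  ultimately have "V - cset x = {u, v}"
    using finite_V by (metis card_subset_eq finite_Diff)
  then show ?thesis using cset_subset_V[OF x] by blast
qed

lemma au_cong: "x i = x j \<Longrightarrow> au i \<longleftrightarrow> au j"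
  by (simp add: au_def)

lemma bu_cong: "x i = x j \<Longrightarrow> bu i \<longleftrightarrow> bu j"
proof -
  assume "x i = x j"
  then have "int c dvd (i + 1) - (j + 1)" using lcyc_eq_iff[OF x] by simp
  then show ?thesis unfolding bu_def using lcyc_eq_iff[OF x, of "i + 1" "j + 1"] by simp
qed

lemma mate: "omitted V adj mu m c x v"
  using x u_V u_off by unfold_locales auto

lemma rev: "omitted V adj mu m c (\<lambda>i. mu (x (- i))) u"
  using lcyc_rev[OF x] u_V u_off by unfold_locales auto

text \<open>Outside C only the mate is available, so \<open>u\<close> and \<open>v\<close> have at
  least m - 1 = c neighbours on C each, while the gap bounds allow 2c in total.\<close>

lemma degree_sums:
  "card (IX x u) + card (IY x u) = c" "card (IY x u) + card (IX x v) = c" "card (IX x u) + card (IY x v) = c"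
proof -
  have d: "c \<le> card (IX x w) + card (IY x w)" if "w \<in> {u, v}" for w
  proof -
    have "nb w - cset x \<subseteq> {u, v} - {w}" using nb_subset_V V_eq adj_irrefl by (auto simp: nb_def)
    then have "card (nb w - cset x) \<le> card ({u, v} - {w})" by (intro card_mono) auto
    also have "\<dots> \<le> 1" using that by (auto simp: card_insert_if)
    finally show ?thesis using degree_split[OF x, of w] min_degree[of w] that u_V m_eq by auto
  qed
  have "card (IY x u) + card (IX x v) \<le> c" "card (IX x u) + card (IY x v) \<le> c"
    using IY_IX_card_le[OF x off_u(1)] IX_IY_card_le[OF x off_u(1)] by auto
  with d[of u] d[of v] show "card (IX x u) + card (IY x u) = c" "card (IY x u) + card (IX x v) = c"
    "card (IX x u) + card (IY x v) = c" by auto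
qed

lemma card_shift: "card {i \<in> {0..<int c}. P (x (i + 1))} = card {i \<in> {0..<int c}. P (x i)}"
proof -
  have "(x (i mod int c + 1) = x (i + 1))" "(x (i mod int c - 1) = x (i - 1))" for i
    by (auto intro!: lcyc_mod_eq[OF x] simp: mod_simps)
  then have "bij_betw (\<lambda>i. (i + 1) mod int c) {i \<in> {0..<int c}. P (x (i + 1))} {i \<in> {0..<int c}. P (x i)}"
    using c_pos
    by (intro bij_betw_byWitness[where f' = "\<lambda>i. (i - 1) mod int c"])
      (auto simp: lcyc_mod[OF x] mod_simps)
  then show ?thesis by (rule bij_betw_same_card)
qed

text \<open>If \<open>u\<close> were adjacent to \<open>y i\<close> and \<open>v\<close> to
  \<open>x (i + 1)\<close>, the edge uv could be inserted between them. So at most one of the two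
  holds for each index, and by \<open>degree_sums\<close> exactly one.\<close>

lemma adj_v_x: "adj v (x (i + 1)) \<longleftrightarrow> \<not> au i"
proof -
  let ?T = "{i \<in> {0..<int c}. adj v (x (i + 1))}"
  have no: "\<not> (au i \<and> adj v (x (i + 1)))" for i
    using insert_gap[OF x off_u(1), of i "i + 1" 1] by (auto simp: au_def)
  have "card ?T = card (IX x v)" using card_shift[of "adj v"] by (simp add: IX_def)
  moreover have "card (IY x u \<union> ?T) = card (IY x u) + card ?T"
    using no by (intro card_Un_disjoint) (auto simp: IY_def au_def)
  ultimately have "card (IY x u \<union> ?T) = card {0..<int c}" using degree_sums by simp
  then have "IY x u \<union> ?T = {0..<int c}" by (intro card_subset_eq) (auto simp: IY_def)
  moreover have "i mod int c \<in> {0..<int c}" using c_pos by simp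
  ultimately have "i mod int c \<in> IY x u \<union> ?T" by blast
  then have "adj u (y (i mod int c)) \<or> adj v (x (i mod int c + 1))" by (auto simp: IY_def)
  moreover have "x (i mod int c + 1) = x (i + 1)" by (auto intro!: lcyc_mod_eq[OF x] simp: mod_simps)
  ultimately have "au i \<or> adj v (x (i + 1))" by (simp add: au_def lcyc_mod[OF x])
  with no show ?thesis by blast
qed

lemma adj_v_y: "adj v (y i) \<longleftrightarrow> \<not> bu i"
  using omitted.adj_v_x[OF mate, of i] omitted.au_def[OF mate, of i] by (auto simp: bu_def)

lemma mate_au: "omitted.au adj mu x v i \<longleftrightarrow> \<not> bu i"
  using omitted.au_def[OF mate] adj_v_y by auto

lemma rev_au: "omitted.au adj mu (\<lambda>i. mu (x (- i))) u i \<longleftrightarrow> bu (- i - 1)"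
  and rev_bu: "omitted.bu adj (\<lambda>i. mu (x (- i))) u i \<longleftrightarrow> au (- i - 1)"
  using omitted.au_def[OF rev] omitted.bu_def[OF rev] by (auto simp: au_def bu_def)

lemma y_chord: "bu i \<Longrightarrow> \<not> au j \<Longrightarrow> x i \<noteq> x j \<Longrightarrow> \<not> adj (y i) (y j)"
  using chord[OF x off_u(1), of i j] adj_v_x by (simp add: bu_def)

lemma x_chord:
  assumes "au i" "\<not> bu j" "x i \<noteq> x j"
  shows "\<not> adj (x (i + 1)) (x (j + 1))"
proof -
  have "x (i + 1) \<noteq> x (j + 1)" using assms(3) by (simp add: lcyc_eq_iff[OF x])
  then show ?thesis
    using omitted.y_chord[OF rev, of "- i - 1" "- j - 1"] assms rev_au[of "- j - 1"] rev_bu[of "- i - 1"]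
    by (simp add: add.commute)
qed

text \<open>The edge from \<open>y i\<close> to \<open>x (i + 1)\<close> has kind U, V, Y or X if,
  respectively, both, neither, only \<open>au i\<close> or only \<open>bu i\<close> holds. In kind Y
  the vertex \<open>y i\<close> is adjacent to both u and v and \<open>x (i + 1)\<close> to neither;
  X is the reverse. Since \<open>au\<close> and \<open>bu\<close> together hold c times in a period,
  U and V occur equally often.\<close>

lemma exists_UV: "(\<exists>i. au i \<and> bu i) \<longleftrightarrow> (\<exists>i. \<not> au i \<and> \<not> bu i)"
proof -
  let ?A = "{i \<in> {0..<int c}. au i}" and ?B = "{i \<in> {0..<int c}. bu i}"
  have "card ?A = card (IY x u)" by (simp add: IY_def au_def)
  moreover have "card ?B = card (IX x u)" using card_shift[of "adj u"] by (simp add: IX_def bu_def)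
  ultimately have "card ?A + card ?B = c" using degree_sums by simp
  then have sum: "card (?A \<union> ?B) + card (?A \<inter> ?B) = c" using card_Un_Int[of ?A ?B] by simp
  have "?A \<inter> ?B = {} \<longleftrightarrow> ?A \<union> ?B = {0..<int c}"
  proof
    assume "?A \<inter> ?B = {}"
    then have "card (?A \<union> ?B) = card {0..<int c}" using sum by simp
    then show "?A \<union> ?B = {0..<int c}" by (intro card_subset_eq) auto
  next
    assume "?A \<union> ?B = {0..<int c}"
    then have "card (?A \<inter> ?B) = 0" using sum by simp
    moreover have "finite (?A \<inter> ?B)" by simp
    ultimately show "?A \<inter> ?B = {}" using card_0_eq by blast
  qed
  moreover have "au (i mod int c) = au i" "bu (i mod int c) = bu i" for i
    by (rule au_cong[OF lcyc_mod[OF x]], rule bu_cong[OF lcyc_mod[OF x]])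
  moreover have "i mod int c \<in> {0..<int c}" for i using c_pos by simp
  ultimately show ?thesis by blast
qed

text \<open>As \<open>u\<close> is adjacent to \<open>y (i - 1)\<close> and \<open>v\<close> to
  \<open>x (i + 1)\<close>, the edge uv can take the place of the matching edge at
  \<open>x i\<close>, which becomes the omitted one.\<close>

lemma swap:
  assumes "au (i - 1)" "\<not> au i"
  shows "omitted V adj mu m c (\<lambda>j. if int c dvd j - i then u else x j) (x i)" (is "omitted _ _ _ _ _ ?x _")
proof -
  have u_ne: "u \<noteq> x j" "x j \<noteq> u" "u \<noteq> mu (x j)" "x j \<noteq> mu u" "mu u \<noteq> x j" "mu (x j) \<noteq> u" for j
    using u_off cset_mem[of x j] cset_mu[of "x j" x] by (metis mu_mu)+
  have u_mu: "u \<noteq> mu u" "mu u \<noteq> u" using mu_neq[OF u_V] by metis+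
  have adj: "adj (mu (?x j)) (?x (j + 1))" for j
  proof (cases "int c dvd j - i")
    case True
    then have "x (j + 1) = x (i + 1)" using lcyc_eq_iff[OF x, of "j + 1" "i + 1"] by simp
    then show ?thesis using True assms(2) adj_v_x[of i] adj_mu[OF u_V] by (auto simp: adj_commute)
  next
    case False
    show ?thesis
    proof (cases "int c dvd j + 1 - i")
      case True
      then have "x j = x (i - 1)" using lcyc_eq_iff[OF x, of j "i - 1"] by (simp add: algebra_simps)
      then show ?thesis using True False assms(1) by (simp add: au_def adj_commute)
    next
      case no: False
      then show ?thesis using False lcycD(3)[OF x, of j] by simp
    qed
  qed
  have period: "?x (j + int c) = ?x j" for j
  proof -
    have "int c dvd j + int c - i \<longleftrightarrow> int c dvd j - i"
      by (metis dvd_add_triv_right_iff diff_add_eq)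
    then show ?thesis using lcycD(2)[OF x] by simp
  qed
  have inj: "int c dvd j - k" if "?x j = ?x k" for j k
  proof (cases "int c dvd j - i \<and> int c dvd k - i")
    case True
    moreover have "j - k = (j - i) - (k - i)" by simp
    ultimately show ?thesis using dvd_diff by metis
  next
    case False
    then have "x j = x k" using that u_ne by (auto split: if_splits)
    then show ?thesis using lcycD(4)[OF x] by simp
  qed
  have ne: "?x j \<noteq> mu (?x k)" for j k
    using u_ne u_mu lcycD(5)[OF x] by auto
  have in_V: "?x j \<in> V" for j using u_V lcycD(1)[OF x] by simp
  have "lcyc ?x" by (rule lcycI[OF in_V period adj inj ne])
  moreover have "x i \<noteq> ?x j" "x i \<noteq> mu (?x j)" for j
    using u_ne lcycD(4)[OF x, of j i] lcycD(5)[OF x, of i j] by (auto dest: sym)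
  then have "x i \<notin> cset ?x" unfolding cset_def by blast
  ultimately show ?thesis using lcycD(1)[OF x] by unfold_locales auto
qed

text \<open>The equalities \<open>adj_v_x\<close> and \<open>adj_v_y\<close> for the cycle in which \<open>u\<close> has replaced \<open>x i\<close>.\<close>

lemma swap_tight:
  assumes i: "au (i - 1)" "\<not> au i" and l: "x l \<noteq> x i" "x l \<noteq> x (i - 1)"
  shows "adj (x i) (y l) \<longleftrightarrow> \<not> adj (y i) (x (l + 1))" "adj (x i) (x (l + 1)) \<longleftrightarrow> \<not> adj (y i) (y l)"
proof -
  have d: "\<not> int c dvd l - i" "\<not> int c dvd l + 1 - i"
    using l lcyc_eq_iff[OF x, of l i] lcyc_eq_iff[OF x, of l "i - 1"] by (auto simp: algebra_simps)
  show "adj (x i) (y l) \<longleftrightarrow> \<not> adj (y i) (x (l + 1))"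
    using omitted.adj_v_x[OF swap[OF i], of l] d unfolding omitted.au_def[OF swap[OF i]] by simp
  show "adj (x i) (x (l + 1)) \<longleftrightarrow> \<not> adj (y i) (y l)"
    using omitted.adj_v_y[OF swap[OF i], of l] d unfolding omitted.bu_def[OF swap[OF i]] by simp
qed

text \<open>Here \<open>v\<close> takes the place of \<open>x i\<close>.\<close>

lemma swap_tight':
  assumes i: "\<not> bu (i - 1)" "bu i" and l: "x l \<noteq> x i" "x l \<noteq> x (i - 1)"
  shows "adj (x i) (x (l + 1)) \<longleftrightarrow> \<not> adj (y i) (y l)"
  using omitted.swap_tight(2)[OF mate, of i l] i l mate_au by simp

text \<open>If kind Y ends at \<open>i\<close>, an exchange at \<open>i\<close> is possible and its
  equalities demand exactly one of two chords. The choice of \<open>j\<close>, of kind V if the edge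
  at \<open>i\<close> is U and of kind U otherwise, makes the chord lemmas exclude both.\<close>

lemma Y_step:
  assumes U: "au l" "bu l" and Y: "au (i - 1)" "\<not> bu (i - 1)"
  shows "au i \<and> \<not> bu i"
proof (rule ccontr)
  assume not_Y: "\<not> (au i \<and> \<not> bu i)"
  obtain k where k: "\<not> au k" "\<not> bu k" using exists_UV U by blast
  define j where "j = (if au i then k else l)"
  have ne: "x j \<noteq> x i" "x j \<noteq> x (i - 1)"
    using U k Y au_cong[of j i] au_cong[of j "i - 1"] bu_cong[of j "i - 1"] by (auto simp: j_def split: if_splits)
  have "\<not> adj (x i) (x (j + 1))"
    using x_chord[of "i - 1" j] x_chord[of j "i - 1"] ne Y U k by (cases "au i") (auto simp: j_def adj_commute)
  moreover have "\<not> adj (y i) (y j)"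
    using y_chord[of i j] y_chord[of j i] ne not_Y U k by (cases "au i") (auto simp: j_def adj_commute)
  moreover have "adj (x i) (x (j + 1)) \<longleftrightarrow> \<not> adj (y i) (y j)"
    using swap_tight(2)[of i j] swap_tight'[of i j] ne Y not_Y by blast
  ultimately show False by blast
qed

text \<open>By \<open>Y_step\<close> kind Y would spread around the whole cycle and reach
  \<open>l\<close>.\<close>

lemma no_Y:
  assumes U: "au l" "bu l"
  shows "\<not> (au i \<and> \<not> bu i)"
proof
  assume Y: "au i \<and> \<not> bu i"
  have all: "au (i + int n) \<and> \<not> bu (i + int n)" for n
  proof (induction n)
    case (Suc n)
    then show ?case using Y_step[OF U, of "i + int n + 1"] by (simp add: add_ac)
  qed (use Y in simp)
  define n where "n = nat ((l - i) mod int c)"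
  have "x (i + int n) = x l" using c_pos unfolding n_def by (intro lcyc_mod_eq[OF x]) (simp add: mod_simps)
  then show False using all[of n] U au_cong bu_cong by blast
qed

text \<open>Reversing the cycle exchanges the kinds X and Y and preserves U.\<close>

lemma no_X:
  assumes U: "au l" "bu l"
  shows "\<not> (\<not> au i \<and> bu i)"
  using omitted.no_Y[OF rev, of "- l - 1" "- i - 1"] U rev_au rev_bu by auto

text \<open>With only X and Y, \<open>u\<close> and \<open>v\<close> would have the same neighbours
  on C, and these c < m vertices would be a cut.\<close>

lemma not_all_XY: "\<exists>i. au i = bu i"
proof (rule ccontr)
  assume "\<nexists>i. au i = bu i"
  then have ne: "au i = (\<not> bu i)" for i by blast
  define S where "S = nb u - {v}"
  have "card (nb u) \<le> c + 1"
  proof -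
    have "nb u - cset x \<subseteq> {v}" using nb_subset_V V_eq adj_irrefl by (auto simp: nb_def)
    then have "card (nb u - cset x) \<le> 1" using card_mono[of "{v}"] by fastforce
    then show ?thesis using degree_split[OF x, of u] degree_sums by simp
  qed
  moreover have "v \<in> nb u" using adj_mu[OF u_V] by (simp add: nb_def)
  ultimately have S: "card S < m" by (simp add: S_def m_eq)
  have "\<exists>a\<in>{u, v}. \<exists>b\<in>V - S - {u, v}. adj a b"
  proof (rule separation[of S])
    show "S \<subseteq> V" using nb_subset_V by (auto simp: S_def)
    show "{u, v} \<union> (V - S - {u, v}) = V - S" using u_V adj_irrefl by (auto simp: S_def nb_def)
    show "V - S - {u, v} \<noteq> {}"
    proof
      assume "V - S - {u, v} = {}"
      then have "card V \<le> card (S \<union> {u, v})"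
        by (intro card_mono) (auto simp: S_def)
      also have "\<dots> \<le> card S + card {u, v}" by (rule card_Un_le)
      also have "card {u, v} \<le> 2" by (simp add: card_insert_if)
      finally show False using S card_V m_eq c_pos by linarith
    qed
  qed (use S in auto)
  then obtain a b where ab: "a = u \<or> a = v" "b \<in> V" "b \<notin> S" "b \<noteq> u" "b \<noteq> v" "adj a b" by auto
  then have nub: "\<not> adj u b" by (auto simp: S_def nb_def)
  then have vb: "adj v b" using ab by blast
  have "b \<in> cset x" using ab V_eq by auto
  then consider j where "b = x (j + 1)" | j where "b = y j" by (auto simp: cset_def) (metis diff_add_cancel)
  then show False
    using ne nub vb adj_v_x adj_v_y by cases (auto simp: au_def bu_def)
qed

lemma au_eq_bu: "au i = bu i"
proof -
  obtain l where U: "au l" "bu l" using not_all_XY exists_UV by blast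
  show "au i = bu i" using no_Y[OF U] no_X[OF U] by blast
qed

section \<open>Changes of \<open>au\<close> and their alternation\<close>

lemma mate_au': "omitted.au adj mu x v i \<longleftrightarrow> \<not> au i"
  using mate_au au_eq_bu by simp

text \<open>After the exchange at \<open>i\<close> the edge from \<open>x i\<close> to
  \<open>y i\<close> is the omitted one, and \<open>au_eq_bu\<close> holds for it as well. With the
  chord lemmas this gives \<open>x i\<close> the neighbours of \<open>u\<close> on C and
  \<open>y i\<close> those of \<open>v\<close>, up to the edge itself.\<close>

lemma switch:
  assumes i: "au (i - 1)" "\<not> au i"
  shows "x l \<noteq> x i \<Longrightarrow> adj (x i) (y l) \<longleftrightarrow> au l"
    and "x l \<noteq> x (i - 1) \<Longrightarrow> adj (x i) (x (l + 1)) \<longleftrightarrow> au l"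
    and "x l \<noteq> x i \<Longrightarrow> adj (y i) (y l) \<longleftrightarrow> \<not> au l"
    and "x l \<noteq> x (i - 1) \<Longrightarrow> adj (y i) (x (l + 1)) \<longleftrightarrow> \<not> au l"
proof -
  have ne: "x (i - 1) \<noteq> x i" using i au_cong by blast
  have generic: "(adj (x i) (y l) \<longleftrightarrow> au l) \<and> (adj (x i) (x (l + 1)) \<longleftrightarrow> au l) \<and>
      (adj (y i) (y l) \<longleftrightarrow> \<not> au l) \<and> (adj (y i) (x (l + 1)) \<longleftrightarrow> \<not> au l)"
    if l: "x l \<noteq> x i" "x l \<noteq> x (i - 1)"
  proof -
    have d: "\<not> int c dvd l - i" "\<not> int c dvd l + 1 - i"
      using l lcyc_eq_iff[OF x, of l i] lcyc_eq_iff[OF x, of l "i - 1"] by (auto simp: algebra_simps)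
    have eq: "adj (x i) (y l) \<longleftrightarrow> adj (x i) (x (l + 1))"
      using omitted.au_eq_bu[OF swap[OF i], of l] omitted.au_def[OF swap[OF i], of l]
        omitted.bu_def[OF swap[OF i], of l] d by simp
    note t = swap_tight[OF i l]
    show ?thesis
    proof (cases "au l")
      case True
      then have "\<not> adj (y i) (y l)" using y_chord[of l i] i l au_eq_bu by (simp add: adj_commute)
      then show ?thesis using t eq True by blast
    next
      case False
      then have "\<not> adj (x i) (x (l + 1))" using x_chord[of "i - 1" l] i l au_eq_bu by simp
      then show ?thesis using t eq False by blast
    qed
  qed
  have x_prev: "x (l + 1) = x i" if "x l = x (i - 1)"
    using that lcyc_eq_iff[OF x, of l "i - 1"] lcyc_eq_iff[OF x, of "l + 1" i] by (simp add: algebra_simps)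
  have x_next: "x (l + 1) = x (i + 1)" if "x l = x i"
    using that lcyc_eq_iff[OF x, of l i] lcyc_eq_iff[OF x, of "l + 1" "i + 1"] by simp
  have e1: "adj (x i) (y (i - 1))" "adj (y i) (x (i + 1))"
    using lcycD(3)[OF x, of "i - 1"] lcycD(3)[OF x, of i] by (auto simp: adj_commute)
  have e2: "\<not> adj (y i) (y (i - 1))" using y_chord[of "i - 1" i] i ne au_eq_bu by (simp add: adj_commute)
  have e3: "\<not> adj (x i) (x (i + 1))" using x_chord[of "i - 1" i] i ne au_eq_bu by simp
  show "adj (x i) (y l) \<longleftrightarrow> au l" if "x l \<noteq> x i"
    using generic e1 i that au_cong[of l "i - 1"] by (cases "x l = x (i - 1)") auto
  show "adj (y i) (y l) \<longleftrightarrow> \<not> au l" if "x l \<noteq> x i"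
    using generic e2 i that au_cong[of l "i - 1"] by (cases "x l = x (i - 1)") auto
  show "adj (x i) (x (l + 1)) \<longleftrightarrow> au l" if "x l \<noteq> x (i - 1)"
    using generic e3 i that au_cong[of l i] x_next by (cases "x l = x i") auto
  show "adj (y i) (x (l + 1)) \<longleftrightarrow> \<not> au l" if "x l \<noteq> x (i - 1)"
    using generic e1 i that au_cong[of l i] x_next by (cases "x l = x i") auto
qed

text \<open>\<open>au\<close> holds at half of the indices. Without such an \<open>s\<close>, the
  neighbours of \<open>y l\<close> would be confined to \<open>v\<close>, c/2 - 1 mates and c/2 of
  the \<open>x j\<close>, only c < m vertices.\<close>

lemma cross_neighbour:
  assumes l: "\<not> au l"
  shows "\<exists>s. au s \<and> adj (y l) (x (s + 1))"
proof (rule ccontr)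
  assume no: "\<nexists>s. au s \<and> adj (y l) (x (s + 1))"
  let ?A = "{i \<in> {0..<int c}. au i}" and ?N = "{i \<in> {0..<int c}. \<not> au i}"
  have "card ?A = card (IY x u)" by (simp add: IY_def au_def)
  moreover have "card ?A = card (IX x u)"
    using card_shift[of "adj u"] au_eq_bu by (simp add: IX_def bu_def)
  ultimately have "2 * card ?A = c" using degree_sums by simp
  moreover have "card ?A + card ?N = c"
  proof -
    have "card ?A + card ?N = card (?A \<union> ?N)" by (rule card_Un_disjoint[symmetric]) auto
    also have "?A \<union> ?N = {0..<int c}" by auto
    finally show ?thesis by simp
  qed
  ultimately have N: "2 * card ?N = c" by simp
  have lN: "l mod int c \<in> ?N" using l c_pos au_cong[OF lcyc_mod[OF x, of l]] by simp
  have "nb (y l) \<subseteq> {v} \<union> (\<lambda>j. y j) ` (?N - {l mod int c}) \<union> (\<lambda>j. x (j + 1)) ` ?N"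
  proof
    fix b assume b: "b \<in> nb (y l)"
    then have adj: "adj (y l) b" by (simp add: nb_def)
    then have "b \<noteq> u" using l by (auto simp: au_def adj_commute)
    moreover have "b \<in> V" using adj adj_V2 by blast
    ultimately consider "b = v" | j where "b = y j" | j where "b = x (j + 1)"
      using V_eq by (auto simp: cset_def) (metis diff_add_cancel)
    then show "b \<in> {v} \<union> (\<lambda>j. y j) ` (?N - {l mod int c}) \<union> (\<lambda>j. x (j + 1)) ` ?N"
    proof cases
      case (2 j)
      then have ne: "x j \<noteq> x l" using adj adj_irrefl by auto
      then have "\<not> au j" using y_chord[of j l] l adj 2 au_eq_bu by (auto simp: adj_commute)
      then have "j mod int c \<in> ?N - {l mod int c}"
        using c_pos au_cong[OF lcyc_mod[OF x, of j]] ne lcyc_mod[OF x] by (auto) metis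
      then show ?thesis using 2 lcyc_mod[OF x, of j] by (auto intro!: image_eqI[of _ _ "j mod int c"])
    next
      case (3 j)
      then have "\<not> au j" using no adj by auto
      then have "j mod int c \<in> ?N" using c_pos au_cong[OF lcyc_mod[OF x, of j]] by simp
      moreover have "x (j mod int c + 1) = x (j + 1)" by (auto intro!: lcyc_mod_eq[OF x] simp: mod_simps)
      ultimately show ?thesis using 3 by (intro UnI2 image_eqI[of _ _ "j mod int c"]) auto
    qed simp
  qed
  then have "card (nb (y l)) \<le> card ({v} \<union> (\<lambda>j. y j) ` (?N - {l mod int c}) \<union> (\<lambda>j. x (j + 1)) ` ?N)"
    by (intro card_mono) auto
  also have "\<dots> \<le> card {v} + card ((\<lambda>j. y j) ` (?N - {l mod int c})) + card ((\<lambda>j. x (j + 1)) ` ?N)"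
    by (rule order_trans[OF card_Un_le add_right_mono[OF card_Un_le]])
  also have "\<dots> \<le> 1 + card (?N - {l mod int c}) + card ?N"
    by (intro add_mono card_image_le) auto
  also have "\<dots> = 2 * card ?N"
  proof -
    have "card ?N > 0" using lN by (metis (no_types, lifting) card_gt_0_iff empty_iff finite_Collect_conjI finite_atLeastLessThan_int finite_subset mem_Collect_eq subsetI)
    then show ?thesis using lN by (simp add: card_Diff_singleton)
  qed
  finally show False using min_degree[of "y l"] lcycD(1)[OF x] N m_eq by simp
qed

lemma sign_change:
  fixes P :: "int \<Rightarrow> bool"
  assumes "P a" "\<not> P b" "a < b"
  shows "\<exists>i. a < i \<and> i \<le> b \<and> P (i - 1) \<and> \<not> P i"
proof (rule ccontr)
  assume no: "\<not> ?thesis"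
  have "P (a + int n)" if "a + int n \<le> b" for n
    using that
  proof (induction n)
    case (Suc n)
    then show ?case using no[simplified, rule_format, of "a + int n + 1"] by (simp add: add_ac)
  qed (use assms in simp)
  from this[of "nat (b - a)"] assms show False by simp
qed

text \<open>A cross neighbour of \<open>y l\<close> and a change of \<open>au\<close> before
  \<open>l - 1\<close> supply the two chords of a cycle that passes through all of C and also
  through \<open>u\<close>.\<close>

lemma no_repeat:
  assumes l: "\<not> au (l - 1)" "\<not> au l"
  shows False
proof -
  obtain s0 where s0: "au s0" "adj (y l) (x (s0 + 1))" using cross_neighbour[OF l(2)] by blast
  define s where "s = l - (l - s0) mod int c"
  have "s mod int c = s0 mod int c" unfolding s_def by (simp add: mod_simps)
  then have "x s = x s0" "x (s + 1) = x (s0 + 1)"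
    using lcyc_mod_eq[OF x, of s s0] lcyc_mod_eq[OF x, of "s + 1" "s0 + 1"] mod_add_cong by blast+
  then have s: "au s" "adj (y l) (x (s + 1))" using s0 au_cong[of s s0] by auto
  have "s \<noteq> l" using s l by auto
  moreover have "0 \<le> (l - s0) mod int c" "(l - s0) mod int c < int c" using c_pos by auto
  ultimately have sl: "s < l" "l < s + int c" by (auto simp: s_def)
  \<comment> \<open>With a change of \<open>au\<close> at \<open>s + 1\<close>,
    \<open>switch\<close> would deny the adjacency of \<open>x (s + 1)\<close> and
    \<open>y l\<close>, unless \<open>x l = x (s + 1)\<close>, which
    \<open>\<not> au (l - 1)\<close> excludes.\<close>
  have s1: "au (s + 1)"
  proof (rule ccontr)
    assume n: "\<not> au (s + 1)"
    have "x l = x (s + 1)" using switch(1)[of "s + 1" l] s n l by (auto simp: adj_commute)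
    then have "x (l - 1) = x s" using lcyc_eq_iff[OF x, of l "s + 1"] lcyc_eq_iff[OF x, of "l - 1" s] by (simp add: algebra_simps)
    then show False using s(1) l(1) au_cong by blast
  qed
  have "s + 1 < l - 1"
  proof -
    have "s + 1 \<noteq> l" "s + 1 \<noteq> l - 1" using s1 l by metis+
    then show ?thesis using sl by linarith
  qed
  then obtain i where i: "s + 1 < i" "i \<le> l - 1" "au (i - 1)" "\<not> au i"
    using sign_change[of au "s + 1" "l - 1"] s1 l by blast
  \<comment> \<open>The new cycle is \<open>?a\<close>, over the cross neighbour to
    \<open>?b\<close>, then \<open>u\<close>, then \<open>?d\<close>, and back to \<open>x i\<close>
    by \<open>switch\<close>; its length is c + 1.\<close>
  let ?a = "map x [i..l]" and ?b = "map x [s + 1..i - 1]" and ?d = "map x [l + 1..s + int c]"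
  have paths: "alt_path ?a" "alt_path ?b" "alt_path ?d" using i sl by (auto intro!: seg_path[OF x])
  have dis: "vset ?b \<inter> vset ?a = {}" "vset ?a \<inter> vset ?d = {}" "vset ?b \<inter> vset ?d = {}"
    using i sl by (auto intro!: seg_disjoint[OF x])
  have sub: "vset ?a \<subseteq> cset x" "vset ?b \<subseteq> cset x" "vset ?d \<subseteq> cset x" by (rule vset_seg)+
  have uu: "u \<notin> cset x" "v \<notin> cset x" using u_off by auto
  have ab: "alt_path (?a @ ?b)"
    using paths dis s(2) i by (subst alt_path_append) (auto simp: seg_simps)
  have ud: "alt_path ([u] @ ?d)"
    using paths(3) u_V sub(3) uu sl l(2) adj_v_x[of l] by (subst alt_path_append) (auto simp: seg_simps)
  have "adj (y (s + int c)) (x i)"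
    using switch(1)[OF i(3,4), of s] s(1) i(4) au_cong[of s i] lcycD(2)[OF x, of s] by (auto simp: adj_commute)
  moreover have "adj (y (i - 1)) u" using i(3) by (simp add: au_def adj_commute)
  ultimately have "alt_cycle ((?a @ ?b) @ ([u] @ ?d))"
    using ab ud dis sub uu i sl by (subst alt_cycle_append) (auto simp: seg_simps)
  from longest[OF this] i sl show False by (simp add: seg_simps)
qed

lemma alternates: "au (i - 1) \<longleftrightarrow> \<not> au i"
  using no_repeat[of i] omitted.no_repeat[OF mate, of i] mate_au' by blast

lemma even_c: "even c"
proof -
  have "au (int n) \<longleftrightarrow> (au 0 \<longleftrightarrow> even n)" for n
  proof (induction n)
    case (Suc n)
    then show ?case using alternates[of "int n + 1"] by (auto simp: add.commute)
  qed simp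
  from this[of c] show ?thesis using au_cong[of "int c" 0] lcycD(2)[OF x, of 0] by auto
qed

section \<open>The two cliques\<close>

definition side :: "'a set" where
  "side = {w \<in> V. w = u \<or> (adj u w \<and> w \<noteq> v)}"

lemma side_mem:
  "x i \<in> side \<longleftrightarrow> au (i - 1)" "y i \<in> side \<longleftrightarrow> au i" "u \<in> side" "v \<notin> side"
proof -
  have ne: "x j \<noteq> u" "x j \<noteq> v" "y j \<noteq> u" "y j \<noteq> v" for j
    using u_off cset_mem[of x j] cset_mu[of "x j" x] by (metis mu_mu)+
  show "x i \<in> side \<longleftrightarrow> au (i - 1)" using ne lcycD(1)[OF x] au_eq_bu[of "i - 1"] by (auto simp: side_def bu_def)
  show "y i \<in> side \<longleftrightarrow> au i" using ne lcycD(1)[OF x] by (auto simp: side_def au_def)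
qed (use u_V mu_neq[OF u_V] in \<open>auto simp: side_def\<close>)

lemma V_cases:
  assumes "b \<in> V"
  obtains j where "b = x j" | j where "b = y j" | "b = u" | "b = v"
  using assms V_eq by (auto simp: cset_def)

lemma side_mu: "a \<in> V \<Longrightarrow> mu a \<in> side \<longleftrightarrow> a \<notin> side"
  by (erule V_cases) (use side_mem alternates in auto)

lemma mate_side: "a \<in> V \<Longrightarrow> a \<in> omitted.side V adj mu v \<longleftrightarrow> a \<notin> side"
  by (erule V_cases) (use side_mem omitted.side_mem[OF mate] mate_au' in auto)

lemma adj_iff_switch:
  assumes i: "au (i - 1)" and a: "a = x i \<or> a = y i" and b: "b \<in> V" "a \<noteq> b"
  shows "adj a b \<longleftrightarrow> (a \<in> side \<longleftrightarrow> b \<in> side) \<or> b = mu a"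
proof -
  have ni: "\<not> au i" using i alternates by blast
  have e: "x (j - 1) = x (i - 1) \<longleftrightarrow> x j = x i" for j by (simp add: lcyc_eq_iff[OF x])
  note sw = switch[OF i ni]
  have mate: "adj (x i) (y i)" "adj (y i) (x i)" using adj_mu[OF lcycD(1)[OF x, of i]] by (auto simp: adj_commute)
  have ne: "x j \<noteq> u" "x j \<noteq> v" "y j \<noteq> u" "y j \<noteq> v" "u \<noteq> x j" "v \<noteq> x j" "u \<noteq> y j" "v \<noteq> y j" "x j \<noteq> y k" "y k \<noteq> x j" for j k
    using u_off cset_mem[of x j] cset_mu[of "x j" x] lcycD(5)[OF x] by (metis mu_mu)+
  show ?thesis using b(1)
  proof (cases rule: V_cases)
    case (1 j)
    have "j = (j - 1) + 1" by simp
    then show ?thesis using 1 a b(2) sw(2)[of "j - 1"] sw(4)[of "j - 1"] e[of j] side_mem i ni mate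
      by (cases "x j = x i") (auto simp: ne)
  next
    case (2 j)
    then show ?thesis using a b(2) sw(1)[of j] sw(3)[of j] side_mem i ni mate au_cong[of j i] mate
      by (cases "x j = x i") (auto simp: ne)
  next
    case 3
    then show ?thesis using a side_mem i ni au_eq_bu[of "i - 1"] by (auto simp: ne au_def bu_def adj_commute)
  next
    case 4
    then show ?thesis using a side_mem i ni au_eq_bu[of i] adj_v_x[of "i - 1"] adj_v_y[of i] by (auto simp: ne adj_commute)
  qed
qed

text \<open>\<open>switch\<close> describes the neighbours of \<open>x i\<close> and
  \<open>y i\<close> only where \<open>au\<close> turns false. As \<open>au\<close> alternates, at
  every other index the same happens for \<open>v\<close> in place of \<open>u\<close>.\<close>

lemma adj_iff:
  assumes "a \<in> V" "b \<in> V" "a \<noteq> b"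
  shows "adj a b \<longleftrightarrow> (a \<in> side \<longleftrightarrow> b \<in> side) \<or> b = mu a"
proof -
  have core: "adj a b \<longleftrightarrow> (a \<in> side \<longleftrightarrow> b \<in> side) \<or> b = mu a"
    if a: "a = x i \<or> a = y i" and b: "b \<in> V" "a \<noteq> b" for a b i
  proof (cases "au (i - 1)")
    case True
    then show ?thesis using adj_iff_switch that by blast
  next
    case False
    moreover have "a \<in> V" using a lcycD(1)[OF x] by auto
    ultimately show ?thesis
      using omitted.adj_iff_switch[OF mate, of i a b] mate_au' mate_side a b by auto
  qed
  have outer: "adj a b \<longleftrightarrow> (a \<in> side \<longleftrightarrow> b \<in> side) \<or> b = mu a"
    if a: "a = u \<or> a = v" and b: "b = u \<or> b = v" "a \<noteq> b" for a b
    using that adj_mu[OF u_V] by (auto simp: adj_commute)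
  have sym: "(b = mu a) = (a = mu b)" for a b :: 'a by auto
  from assms(1) show ?thesis
  proof (cases rule: V_cases)
    case 3
    from assms(2) show ?thesis
      by (cases rule: V_cases) (use core[of b _ a] outer[of a b] assms 3 adj_commute[of a b] sym[of a b] in auto)
  next
    case 4
    from assms(2) show ?thesis
      by (cases rule: V_cases) (use core[of b _ a] outer[of a b] assms 4 adj_commute[of a b] sym[of a b] in auto)
  qed (use core[of a _ b] assms in auto)
qed

end

section \<open>The theorem for graphs given by a mate function\<close>

context matched_graph
begin

definition exceptional :: "'a set \<Rightarrow> bool" where
  "exceptional P \<longleftrightarrow> P \<subseteq> V \<and> (\<forall>a\<in>V. mu a \<in> P \<longleftrightarrow> a \<notin> P) \<and>
     (\<forall>a\<in>V. \<forall>b\<in>V. adj a b \<longleftrightarrow> a \<noteq> b \<and> ((a \<in> P \<longleftrightarrow> b \<in> P) \<or> b = mu a))"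

theorem alternating_hamilton_cycle_or_exceptional:
  assumes card: "card V = 2 * m" "0 < m"
    and sep: "\<And>S A B. S \<subseteq> V \<Longrightarrow> card S < m \<Longrightarrow> A \<union> B = V - S \<Longrightarrow> A \<inter> B = {} \<Longrightarrow> A \<noteq> {} \<Longrightarrow> B \<noteq> {}
      \<Longrightarrow> \<exists>a\<in>A. \<exists>b\<in>B. adj a b"
  shows "(\<exists>xs. alt_cycle xs \<and> length xs = m) \<or> (odd m \<and> 3 \<le> m \<and> (\<exists>P. exceptional P))"
proof (cases "\<exists>xs. alt_cycle xs \<and> length xs = m")
  case False
  have bound: "length xs \<le> m" if "alt_cycle xs" for xs
  proof -
    have "alt_path xs" using that by (simp add: alt_cycle_def)
    then have "2 * length xs \<le> card V" using card_vset vset_subset_V finite_V by (metis card_mono)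
    then show ?thesis using card by simp
  qed
  obtain a where a: "a \<in> V" using card by fastforce
  have "\<forall>xs. alt_cycle xs \<longrightarrow> length xs < Suc m" using bound by (simp add: less_Suc_eq_le)
  from ex_has_greatest_nat[of alt_cycle, OF alt_cycle_singleton[OF a] this]
  obtain xs where xs: "alt_cycle xs" "\<And>ys. alt_cycle ys \<Longrightarrow> length ys \<le> length xs" by blast
  define c where "c = length xs"
  have "c < m" using bound[OF xs(1)] False xs(1) unfolding c_def by fastforce
  then interpret longest_cycle V adj mu m c
    using card sep xs by unfold_locales (auto simp: c_def)
  obtain x where x: "lcyc x" using obtain_lcyc[OF xs(1)] by (auto simp: c_def)
  obtain u where u: "u \<in> V" "u \<notin> cset x" using card_rest[OF x] omitted_single[OF x]
    by (metis DiffD1 DiffD2 all_not_in_conv add_diff_cancel_left' card.empty nat_mult_1_right zero_neq_numeral)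
  interpret omitted V adj mu m c x u using x u by unfold_locales
  have "exceptional side"
    using side_mu adj_iff adj_irrefl by (auto simp: exceptional_def) (auto simp: side_def)
  \<comment> \<open>c is even and positive, hence at least 2, and m = c + 1.\<close>
  moreover have "odd m" "3 \<le> m" using even_c c_pos by (auto simp: m_eq elim!: evenE)
  ultimately show ?thesis by blast
qed simp

end

section \<open>Symmetric digraphs with a perfect matching\<close>

lemma pcas_upt: "i \<le> j \<Longrightarrow> pcas (w i) (map (\<lambda>k. (w k, w (Suc k))) [i..<j]) (w j)"
  by (induction rule: inc_induct) (auto simp: upt_conv_Cons)

lemma pawalk_verts_upt: "i \<le> j \<Longrightarrow> pawalk_verts (w i) (map (\<lambda>k. (w k, w (Suc k))) [i..<j]) = map w [i..<Suc j]"
  by (induction rule: inc_induct) (auto simp: upt_conv_Cons simp del: upt_Suc)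

lemma cycle_of_sequence:
  assumes N: "0 < N" and inj: "inj_on w {..<N}" and closed: "w N = w 0"
    and V: "w 0 \<in> pverts G" and arcs: "\<And>k. k < N \<Longrightarrow> (w k, w (Suc k)) \<in> parcs G"
  shows "pre_digraph.cycle (with_proj G) (map (\<lambda>k. (w k, w (Suc k))) [0..<N])"
proof -
  interpret pair_pre_digraph G .
  \<comment> \<open>The library asks for distinct vertices after dropping the first, so the repeated
    vertex \<open>w N = w 0\<close> counts only at its last occurrence.\<close>
  have "distinct (map w [1..<Suc N])"
  proof -
    have "w a \<noteq> w b" if "a < b" "b \<le> N" "0 < a" for a b
      using that inj closed N inj_onD[OF inj, of a b] inj_onD[OF inj, of a 0] by (cases "b = N") auto
    then have "inj_on w {1..<Suc N}" by (intro linorder_inj_onI) auto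
    then show ?thesis by (simp add: distinct_map del: upt_Suc)
  qed
  moreover have "pawalk_verts (w 0) (map (\<lambda>k. (w k, w (Suc k))) [0..<N]) = map w [0..<Suc N]"
    by (rule pawalk_verts_upt) simp
  then have "tl (pawalk_verts (w 0) (map (\<lambda>k. (w k, w (Suc k))) [0..<N])) = map w [1..<Suc N]"
    by (simp add: upt_conv_Cons del: upt_Suc)
  moreover have "pcas (w 0) (map (\<lambda>k. (w k, w (Suc k))) [0..<N]) (w 0)"
    using pcas_upt[of 0 N w] closed by simp
  ultimately show ?thesis
    unfolding cycle_def awalk_def using V arcs N by (intro exI[of _ "w 0"]) (auto simp del: upt_Suc)
qed

text \<open>Connectedness means reachability in the symmetric closure, so \<open>no\<close> covers
  both directions; a walk that starts in \<open>A\<close> then never leaves it.\<close>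

lemma not_connected_separated:
  assumes "a \<in> A" "b \<in> B" "A \<union> B = U" "A \<inter> B = {}"
    and no: "\<And>a b. a \<in> A \<Longrightarrow> b \<in> B \<Longrightarrow> (a, b) \<notin> parcs G \<and> (b, a) \<notin> parcs G"
  shows "\<not> connected (with_proj G \<restriction> U)"
proof
  let ?H = "mk_symmetric (with_proj G \<restriction> U)"
  assume "connected (with_proj G \<restriction> U)"
  moreover have "pverts ?H = U" by (simp add: mk_symmetric_def)
  ultimately have "(a, b) \<in> rtrancl_on U (parcs ?H)"
    using assms(1-3) by (auto simp: connected_def strongly_connected_def reachable_def)
  then have "b \<in> A"
  proof (induction rule: rtrancl_on_induct)
    case (step y z)
    have arcs: "parcs ?H \<subseteq> {(p, q). p \<in> U \<and> q \<in> U \<and> ((p, q) \<in> parcs G \<or> (q, p) \<in> parcs G)}"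
      by (auto simp: mk_symmetric_def induce_subgraph_def)
    then show ?case using step assms(3) no by blast
  qed (use assms in auto)
  with assms show False by blast
qed

text \<open>Each entry contributes itself and its mate. For n = 1 the closing step would run back
  along the matching edge and spoil the last property, hence \<open>2 \<le> n\<close>.\<close>

lemma (in matched_graph) alternating_sequence:
  assumes xs: "alt_cycle xs" and n: "length xs = n" "2 \<le> n"
  obtains w where "inj_on w {..<2 * n}" "w (2 * n) = w 0" "w ` {..<2 * n} = vset xs"
    "\<And>k. adj (w k) (w (Suc k))" "\<And>k. w (Suc k) = mu (w k) \<longleftrightarrow> even k"
proof
  define w where "w k = (if even k then xs ! ((k div 2) mod n) else mu (xs ! ((k div 2) mod n)))" for k
  have p: "set xs \<subseteq> V" "distinct xs" "set xs \<inter> mu ` set xs = {}" "alt_path xs" "adj (mu (last xs)) (hd xs)"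
    using xs by (auto simp: alt_cycle_def alt_path_def)
  have mem: "xs ! (i mod n) \<in> set xs" for i using n by auto
  have ne: "xs ! (i mod n) \<noteq> mu (xs ! (j mod n))" "mu (xs ! (j mod n)) \<noteq> xs ! (i mod n)" for i j
    using mem[of i] imageI[OF mem[of j], of mu] p(3) by (metis disjoint_iff)+
  have eq: "xs ! (i mod n) = xs ! (j mod n) \<longleftrightarrow> i mod n = j mod n" for i j
    using p(2) n by (subst nth_eq_iff_index_eq) auto
  show "inj_on w {..<2 * n}"
  proof (rule inj_onI)
    fix k l assume kl: "k \<in> {..<2 * n}" "l \<in> {..<2 * n}" "w k = w l"
    then have "even k \<longleftrightarrow> even l"
      using ne[of "k div 2" "l div 2"] ne[of "l div 2" "k div 2"] by (auto simp: w_def split: if_splits)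
    moreover have "k div 2 < n" "l div 2 < n" using kl by auto
    then have "k div 2 = l div 2" using kl(3) calculation eq[of "k div 2" "l div 2"] by (auto simp: w_def split: if_splits)
    ultimately show "k = l" by (metis even_two_times_div_two odd_two_times_div_two_succ)
  qed
  show "w (2 * n) = w 0" by (simp add: w_def)
  show "w ` {..<2 * n} = vset xs"
  proof
    show "w ` {..<2 * n} \<subseteq> vset xs" using mem by (auto simp: w_def vset_def)
    show "vset xs \<subseteq> w ` {..<2 * n}"
    proof
      fix a assume "a \<in> vset xs"
      then consider i where "i < n" "a = xs ! i" | i where "i < n" "a = mu (xs ! i)"
        using n(1) unfolding vset_def by (auto simp: in_set_conv_nth)
      then show "a \<in> w ` {..<2 * n}"
      proof cases
        case (1 i)
        then show ?thesis by (intro image_eqI[of _ _ "2 * i"]) (auto simp: w_def)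
      next
        case (2 i)
        then show ?thesis by (intro image_eqI[of _ _ "2 * i + 1"]) (auto simp: w_def)
      qed
    qed
  qed
  have link: "adj (mu (xs ! (i mod n))) (xs ! (Suc i mod n))" for i
  proof (cases "Suc (i mod n) < n")
    case True
    then show ?thesis using alt_path_nth_adj[OF p(4), of "i mod n"] n by (simp add: mod_Suc)
  next
    case False
    then have "i mod n = n - 1" using n mod_less_divisor[of n i] by linarith
    moreover have "Suc i mod n = 0" using False n by (simp add: mod_Suc) (metis Suc_lessI mod_less_divisor zero_less_iff_neq_zero not_numeral_le_zero)
    ultimately show ?thesis using p(5) n alt_path_not_Nil[OF p(4)] by (simp add: last_conv_nth hd_conv_nth)
  qed
  have in_V: "xs ! (i mod n) \<in> V" for i using mem[of i] p(1) by blast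
  show "adj (w k) (w (Suc k))" for k
    using link[of "k div 2"] adj_mu[OF in_V[of "k div 2"]] by (auto simp: w_def)
  show "w (Suc k) = mu (w k) \<longleftrightarrow> even k" for k
  proof (cases "even k")
    case False
    have "Suc (k div 2) mod n \<noteq> k div 2 mod n" using n by (simp add: mod_Suc)
    then show ?thesis using False eq[of "Suc (k div 2)" "k div 2"] by (simp add: w_def)
  qed (simp add: w_def)
qed

section \<open>Perfect matchings as involutions\<close>

locale matching = pair_graph G for G :: "'a pair_pre_digraph" +
  fixes M :: "'a set set"
  assumes M: "perfect_matching G M"
begin

lemma M_edge: "e \<in> M \<Longrightarrow> \<exists>a b. e = {a, b} \<and> a \<noteq> b \<and> (a, b) \<in> parcs G"
proof -
  assume "e \<in> M"
  then obtain f where "f \<in> parcs G" "e = {fst f, snd f}"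
    using M unfolding perfect_matching_def uedges_def uedge_def by blast
  then show ?thesis using no_loops'[of "fst f" "snd f"] by (metis prod.collapse)
qed

lemma M_unique: "e \<in> M \<Longrightarrow> f \<in> M \<Longrightarrow> a \<in> e \<Longrightarrow> a \<in> f \<Longrightarrow> e = f"
  using M unfolding perfect_matching_def pairwise_def disjnt_def by blast

text \<open>The identity off the graph makes it an involution on the whole type, as
  \<open>mu_mu\<close> requires.\<close>

definition partner :: "'a \<Rightarrow> 'a" where
  "partner a = (if a \<in> pverts G then THE b. {a, b} \<in> M else a)"

lemma partner_M: "a \<in> pverts G \<Longrightarrow> {a, partner a} \<in> M"
proof -
  assume a: "a \<in> pverts G"
  then obtain e where "e \<in> M" "a \<in> e" using M unfolding perfect_matching_def by blast
  then obtain b where b: "{a, b} \<in> M" using M_edge[of e] by (auto simp: insert_commute)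
  moreover have "c = b" if "{a, c} \<in> M" for c
    using M_unique[OF that b, of a] by (auto simp: doubleton_eq_iff)
  ultimately have "{a, THE b. {a, b} \<in> M} \<in> M" by (rule theI)
  then show ?thesis using a by (simp add: partner_def)
qed

lemma partner_arc: "a \<in> pverts G \<Longrightarrow> (a, partner a) \<in> parcs G"
  using M_edge[OF partner_M[of a]] arcs_symmetric by (auto simp: doubleton_eq_iff)

lemma M_iff: "{a, b} \<in> M \<longleftrightarrow> a \<in> pverts G \<and> b = partner a"
proof
  assume ab: "{a, b} \<in> M"
  then have a: "a \<in> pverts G" using M by (auto simp: perfect_matching_def)
  then show "a \<in> pverts G \<and> b = partner a"
    using M_unique[OF ab partner_M[OF a], of a] by (auto simp: doubleton_eq_iff)
qed (use partner_M in auto)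

lemma partner_partner: "partner (partner a) = a"
proof (cases "a \<in> pverts G")
  case True
  then have "{partner a, a} \<in> M" using partner_M by (simp add: insert_commute)
  then show ?thesis using M_iff by metis
qed (simp add: partner_def)

sublocale matched_graph "pverts G" "\<lambda>a b. (a, b) \<in> parcs G" partner
proof
  show "finite (pverts G)" by simp
  show "partner a \<in> pverts G" if "a \<in> pverts G" for a
    using partner_arc[OF that] wellformed' by blast
qed (use arcs_symmetric no_loops' wellformed' partner_partner partner_arc in blast)+

lemma M_edge_partner: "e \<in> M \<Longrightarrow> \<exists>a\<in>pverts G. e = {a, partner a}"
  using M_edge M_iff by metis

lemma card_pverts: "card (pverts G) = 2 * card M"
proof -
  have c: "card e = 2" if "e \<in> M" for e using M_edge[OF that] by auto
  have "card (\<Union> M) = sum card M"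
    using M c by (intro card_Union_disjoint) (auto simp: perfect_matching_def intro: card_ge_0_finite)
  also have "\<dots> = 2 * card M" using c by simp
  finally show ?thesis using M by (simp add: perfect_matching_def)
qed

lemma hamilton_cycle_of_alt_cycle:
  assumes xs: "alt_cycle xs" "length xs = card M" "2 \<le> card M"
  shows "\<exists>p. hamilton_cycle G p \<and> alternating_cycle M p"
proof -
  define n where "n = card M"
  then have n: "length xs = n" "2 \<le> n" using xs by auto
  obtain w where inj: "inj_on w {..<2 * n}" and closed: "w (2 * n) = w 0" and range: "w ` {..<2 * n} = vset xs"
    and arc: "\<And>k. (w k, w (Suc k)) \<in> parcs G" and alt: "\<And>k. w (Suc k) = partner (w k) \<longleftrightarrow> even k"
    by (rule alternating_sequence[OF xs(1) n]) (rule that)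
  define p where "p = map (\<lambda>k. (w k, w (Suc k))) [0..<2 * n]"
  have w_V: "w k \<in> pverts G" for k using arc[of k] wellformed' by blast
  have path: "alt_path xs" using xs by (simp add: alt_cycle_def)
  have "vset xs = pverts G"
    using card_vset[OF path] vset_subset_V[OF path] card_pverts xs(2) by (intro card_subset_eq) auto
  then have "fst ` set p = pverts G"
    using range by (auto simp: p_def image_image lessThan_atLeast0)
  moreover have "pre_digraph.cycle (with_proj G) p"
    unfolding p_def using xs n_def inj closed w_V arc by (intro cycle_of_sequence) auto
  moreover have "3 \<le> length p" using xs by (simp add: p_def n_def)
  moreover have "alternating_cycle M p"
  proof -
    \<comment> \<open>The parity of the position decides membership in M, and reduction modulo the
      even number 2n preserves parity, also at the closing edge.\<close>
    have e: "uedge (p ! i) \<in> M \<longleftrightarrow> even i" if "i < length p" for i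
      using that w_V alt M_iff by (simp add: p_def uedge_def)
    have "even (Suc i mod (2 * n)) \<longleftrightarrow> odd i" for i
      by (metis dvd_mod_iff dvd_triv_left even_Suc)
    moreover have "Suc i mod (2 * n) < length p" for i using xs by (simp add: p_def n_def)
    ultimately show ?thesis unfolding alternating_cycle_def using e by (simp add: p_def)
  qed
  ultimately show ?thesis unfolding hamilton_cycle_def by blast
qed

lemma labelling_of_exceptional:
  assumes P: "exceptional P" and n: "card M = 2 * n + 1"
  obtains x y where "G1_labelling n x y G" "M = {{x i, y i} | i. i \<in> {1..2 * n + 1}}"
proof -
  have PV: "P \<subseteq> pverts G" and side: "\<And>a. a \<in> pverts G \<Longrightarrow> partner a \<in> P \<longleftrightarrow> a \<notin> P"
    and arcs: "\<And>a b. a \<in> pverts G \<Longrightarrow> b \<in> pverts G \<Longrightarrow>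
      (a, b) \<in> parcs G \<longleftrightarrow> a \<noteq> b \<and> ((a \<in> P \<longleftrightarrow> b \<in> P) \<or> b = partner a)"
    using P by (auto simp: exceptional_def)
  have compl: "pverts G - P = partner ` P"
  proof
    show "pverts G - P \<subseteq> partner ` P"
    proof
      fix a assume a: "a \<in> pverts G - P"
      then have "partner a \<in> P" using side by blast
      then show "a \<in> partner ` P" by (metis image_eqI mu_mu)
    qed
    show "partner ` P \<subseteq> pverts G - P" using PV side by auto
  qed
  have fin: "finite P" using PV finite_V by (rule finite_subset)
  have "card (pverts G) = card P + card (partner ` P)"
    using PV compl fin by (metis card_Diff_subset card_mono finite_V le_add_diff_inverse)
  then have card_P: "card P = 2 * n + 1" using card_pverts n by (simp add: card_image inj_mu)
  then obtain x where x: "bij_betw x {1..2 * n + 1} P"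
    using ex_bij_betw_nat_finite_1[OF fin] by auto
  define y where "y = partner \<circ> x"
  let ?I = "{1..2 * n + 1}"
  have xP: "x ` ?I = P" and x_inj: "inj_on x ?I" using x by (auto simp: bij_betw_def)
  have yP: "y ` ?I = pverts G - P" unfolding y_def image_comp[symmetric] xP compl ..
  have y_inj: "inj_on y ?I" unfolding y_def using x_inj inj_mu by (intro comp_inj_on)
  have xI: "x i \<in> P" "x i \<in> pverts G" "y i \<notin> P" "y i \<in> pverts G" if "i \<in> ?I" for i
    using that xP yP PV by blast+
  have y_eq: "y i = partner (x i)" "x i = partner (y i)" for i by (auto simp: y_def)
  have eq_iff: "x i = x j \<longleftrightarrow> i = j" "y i = y j \<longleftrightarrow> i = j" if "i \<in> ?I" "j \<in> ?I" for i j
    using that x_inj y_inj by (auto simp: inj_on_def)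
  have cover: "\<exists>i\<in>?I. a = x i \<or> a = y i" if "a \<in> pverts G" for a
    using that xP yP by blast
  have "parcs G = {(x i, x j) | i j. i \<in> ?I \<and> j \<in> ?I \<and> i \<noteq> j} \<union>
      {(y i, y j) | i j. i \<in> ?I \<and> j \<in> ?I \<and> i \<noteq> j} \<union>
      {(x i, y i) | i. i \<in> ?I} \<union> {(y i, x i) | i. i \<in> ?I}" (is "_ = ?R")
  proof (intro equalityI subrelI)
    fix a b assume ab: "(a, b) \<in> parcs G"
    then have V: "a \<in> pverts G" "b \<in> pverts G" using wellformed' by blast+
    then obtain i j where ij: "i \<in> ?I" "a = x i \<or> a = y i" "j \<in> ?I" "b = x j \<or> b = y j"
      using cover by meson
    have c: "a \<noteq> b" "(a \<in> P \<longleftrightarrow> b \<in> P) \<or> b = partner a" using arcs[OF V] ab by auto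
    show "(a, b) \<in> ?R"
    proof (cases "a \<in> P \<longleftrightarrow> b \<in> P")
      case True
      then have "a = x i \<and> b = x j \<or> a = y i \<and> b = y j" using ij xI by metis
      moreover have "i \<noteq> j" using c(1) calculation by auto
      ultimately show ?thesis using ij(1,3) by blast
    next
      case False
      then have "b = partner a" using c by blast
      then have "a = x i \<and> b = y i \<or> a = y i \<and> b = x i" using ij(2) y_eq by metis
      then show ?thesis using ij(1) by blast
    qed
  next
    fix a b assume "(a, b) \<in> ?R"
    then consider i j where "i \<in> ?I" "j \<in> ?I" "i \<noteq> j" "a = x i" "b = x j"
      | i j where "i \<in> ?I" "j \<in> ?I" "i \<noteq> j" "a = y i" "b = y j"
      | i where "i \<in> ?I" "a = x i" "b = y i" | i where "i \<in> ?I" "a = y i" "b = x i"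
      by blast
    then show "(a, b) \<in> parcs G"
    proof cases
      case 1 then show ?thesis using arcs[of a b] xI eq_iff by metis
    next
      case 2 then show ?thesis using arcs[of a b] xI eq_iff by metis
    next
      case 3 then show ?thesis using arcs[of a b] xI y_eq by metis
    next
      case 4 then show ?thesis using arcs[of a b] xI y_eq by metis
    qed
  qed
  moreover have "pverts G = x ` ?I \<union> y ` ?I" "x ` ?I \<inter> y ` ?I = {}" unfolding xP yP using PV by auto
  ultimately have "G1_labelling n x y G"
    unfolding G1_labelling_def Let_def using x_inj y_inj by blast
  moreover have "M = {{x i, y i} | i. i \<in> ?I}"
  proof (intro equalityI subsetI)
    fix e assume "e \<in> M"
    then obtain a where a: "a \<in> pverts G" "e = {a, partner a}" using M_edge_partner by blast
    then obtain i where i: "i \<in> ?I" "a = x i \<or> a = y i" using cover by blast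
    then have "e = {x i, y i}" unfolding a(2) using y_eq[of i] by (metis insert_commute)
    then show "e \<in> {{x i, y i} | i. i \<in> ?I}" using i(1) by blast
  next
    fix e assume "e \<in> {{x i, y i} | i. i \<in> ?I}"
    then obtain i where "i \<in> ?I" "e = {x i, y i}" by blast
    then show "e \<in> M" using xI[of i] by (simp add: M_iff y_def)
  qed
  ultimately show thesis by (rule that)
qed

end

theorem theorem4p2:
  fixes G :: "'a pair_pre_digraph" and M :: "'a set set"
  assumes "pair_graph G"
    and "connected (with_proj G)"
    and "card (pverts G) \<noteq> 2"
    and "real (vertex_connectivity G) \<ge> real (card (pverts G)) / 2"
    and "perfect_matching G M"
  shows "(\<exists>p. hamilton_cycle G p \<and> alternating_cycle M p) \<or>
         (G \<in> class_G1 \<and> jointing_matching G M)"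
proof -
  interpret pair_graph G by fact
  interpret matching G M by unfold_locales fact
  have "pverts G \<noteq> {}"
    using assms(2) by (simp add: connected_def strongly_connected_def mk_symmetric_def)
  then have m: "2 \<le> card M" using card_pverts assms(3) finite_V by (cases "card M = 0"; cases "card M = 1") auto
  have kappa: "card M \<le> vertex_connectivity G" using assms(4) card_pverts by simp
  \<comment> \<open>Otherwise deleting \<open>S\<close> would leave a disconnected graph, and the
    connectivity would be at most \<open>card S\<close>.\<close>
  have sep: "\<exists>a\<in>A. \<exists>b\<in>B. (a, b) \<in> parcs G"
    if S: "S \<subseteq> pverts G" "card S < card M" and AB: "A \<union> B = pverts G - S" "A \<inter> B = {}" "A \<noteq> {}" "B \<noteq> {}"
    for S A B
  proof (rule ccontr)
    assume no: "\<not> ?thesis"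
    obtain a b where "a \<in> A" "b \<in> B" using AB by blast
    then have "\<not> connected (with_proj G \<restriction> (pverts G - S))"
      using not_connected_separated[of a A b B "pverts G - S" G] AB no arcs_symmetric by blast
    then have "vertex_connectivity G \<le> card S"
      unfolding vertex_connectivity_def using S by (intro Least_le) blast
    with kappa S show False by simp
  qed
  have "(\<exists>xs. alt_cycle xs \<and> length xs = card M) \<or> (odd (card M) \<and> 3 \<le> card M \<and> (\<exists>P. exceptional P))"
    using m by (intro alternating_hamilton_cycle_or_exceptional card_pverts sep) auto
  then consider xs where "alt_cycle xs" "length xs = card M"
    | P where "odd (card M)" "3 \<le> card M" "exceptional P"
    by blast
  then show ?thesis
  proof cases
    case 1
    then show ?thesis using hamilton_cycle_of_alt_cycle m by blast
  next
    case 2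
    then obtain n where n: "card M = 2 * n + 1" by (auto elim: oddE)
    obtain x y where "G1_labelling n x y G" "M = {{x i, y i} | i. i \<in> {1..2 * n + 1}}"
      using labelling_of_exceptional[OF 2(3) n] .
    moreover have "1 \<le> n" using n 2 by simp
    ultimately show ?thesis unfolding class_G1_def jointing_matching_def by blast
  qed
qed

end
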